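(* Let $\mathcal P$ be a Darboux complete ordered set. If $\mathcal A$ is a completely integrally closed subgroup of $\mathrm{OP}(\widehat{\mathcal P})$, then $\mathrm{BDar}(\mathrm{id}_{\mathcal A})$ is a subgroup of $\mathrm{OP}(\widehat{\mathcal P})$, where $\mathrm{id}_{\mathcal A}:\mathrm{OP}(\widehat{\mathcal P})\rightharpoonup\mathrm{OP}(\widehat{\mathcal P})$ denotes the partial function with domain $\mathcal A$ given by the identity.
   Context: Ordered set means partially ordered set. For an ordered set $\mathcal P$, $\widehat{\mathcal P}=\mathcal P\cup\{-\infty,+\infty\}$ is obtained by adjoining a new least element $-\infty$ and a new greatest element $+\infty$. $\mathrm{OP}(\mathcal Q)$ is the set of order preserving functions $\mathcal Q\to\mathcal Q$, ordered pointwise; it is a monoid under composition. A subgroup of $\mathrm{OP}(\mathcal Q)$ is a submonoid (containing $\mathrm{id}_{\mathcal Q}$) in which every element has an inverse lying in the submonoid. A subgroup $\mathcal A$ of $\mathrm{OP}(\mathcal Q)$ is completely integrally closed if for all $a,a'\in\mathcal A$, $a^n\le a'$ for all $n\in\mathbb N$ implies $a\le\mathrm{id}_{\mathcal Q}$. A partial function $\psi:\mathcal O\rightharpoonup\mathcal R$ between ordered sets is an order preserving function $\psi:\mathrm{dom}(\psi)\to\mathcal R$ defined on a subset $\mathrm{dom}(\psi)\subseteq\mathcal O$ with the induced order. An extension of $\psi$ to $\mathcal O$ is an order preserving function $f:\mathcal O\to\mathcal R$ whose restriction to $\mathrm{dom}(\psi)$ is $\psi$. $\psi$ is extremizable if there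 exist extensions $\mathrm{lex}_\psi,\mathrm{uex}_\psi:\mathcal O\to\mathcal R$ of $\psi$ with $\mathrm{lex}_\psi\le f\le\mathrm{uex}_\psi$ pointwise for every extension $f$ of $\psi$ to $\mathcal O$. In that case $\mathrm{Dar}(\psi)=\{x\in\mathcal O\mid\mathrm{lex}_\psi(x)=\mathrm{uex}_\psi(x)\}$, and $\mathrm{BDar}(\psi)$ is the set of those $x\in\mathrm{Dar}(\psi)$ for which there exist $y,z\in\mathrm{dom}(\psi)$ with $y\le x\le z$. An ordered set $\mathcal P$ is Darboux complete if every partial function from $\widehat{\mathcal P}$ to itself is extremizable; in that case every partial function with codomain $\mathrm{OP}(\widehat{\mathcal P})$ is extremizable. *)

theory Defs
  imports "HOL-Library.Extended" "HOL-Library.FuncSet" "HOL-Algebra.Group"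
begin

text \<open>
  An ordered set is a subset (possibly empty) of a type of class \<open>order\<close>, with the induced order.
\<close>

definition hat :: "'a::order set \<Rightarrow> 'a extended set" where
  "hat P = insert Minf (insert Pinf (Fin ` P))"

text \<open>
  Functions between carriers are extensional (equal to \<open>undefined\<close> outside the domain), so that the
  order \<open>\<le>\<close> of the function type restricts to the pointwise order on the carrier; see
  \<open>extensional_le_iff\<close> below.
\<close>

definition OP :: "'a::order set \<Rightarrow> ('a \<Rightarrow> 'a) set" where
  "OP Q = {f \<in> Q \<rightarrow>\<^sub>E Q. mono_on Q f}"

definition OP_monoid :: "'a::order set \<Rightarrow> ('a \<Rightarrow> 'a) monoid" where
  "OP_monoid Q = \<lparr>carrier = OP Q, monoid.mult = compose Q, one = (\<lambda>x\<in>Q. x)\<rparr>"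

text \<open>
  The predicate \<^const>\<open>subgroup\<close> is not used: it refers to \<open>inv\<close>, which is unspecified on the
  non-invertible elements of a monoid.
\<close>

definition subgroup_of_monoid :: "'a set \<Rightarrow> ('a, 'b) monoid_scheme \<Rightarrow> bool" where
  "subgroup_of_monoid A M \<longleftrightarrow>
     submonoid A M \<and>
     (\<forall>a\<in>A. \<exists>b\<in>A. a \<otimes>\<^bsub>M\<^esub> b = \<one>\<^bsub>M\<^esub> \<and> b \<otimes>\<^bsub>M\<^esub> a = \<one>\<^bsub>M\<^esub>)"

text \<open>
  For a subgroup it does not matter whether \<open>n\<close> starts at \<open>0\<close> or \<open>1\<close>: if \<open>a ^ n \<le> a'\<close> for all
  \<open>n \<ge> 1\<close>, then \<open>a ^ n \<le> a' a\<inverse>\<close> for all \<open>n \<ge> 0\<close>.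
\<close>

definition completely_integrally_closed :: "'a::order set \<Rightarrow> ('a \<Rightarrow> 'a) set \<Rightarrow> bool" where
  "completely_integrally_closed Q A \<longleftrightarrow>
     (\<forall>a\<in>A. \<forall>a'\<in>A. (\<forall>n::nat. a [^]\<^bsub>OP_monoid Q\<^esub> n \<le> a') \<longrightarrow> a \<le> \<one>\<^bsub>OP_monoid Q\<^esub>)"

definition partial_function_on ::
    "'a::order set \<Rightarrow> 'b::order set \<Rightarrow> ('a \<rightharpoonup> 'b) \<Rightarrow> bool" where
  "partial_function_on X R \<psi> \<longleftrightarrow>
     dom \<psi> \<subseteq> X \<and> ran \<psi> \<subseteq> R \<and> mono_on (dom \<psi>) (the \<circ> \<psi>)"

definition extensions ::
    "'a::order set \<Rightarrow> 'b::order set \<Rightarrow> ('a \<rightharpoonup> 'b) \<Rightarrow> ('a \<Rightarrow> 'b) set" where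
  "extensions X R \<psi> = {f \<in> X \<rightarrow>\<^sub>E R. mono_on X f \<and> (\<forall>x\<in>dom \<psi>. \<psi> x = Some (f x))}"

definition extremizable :: "'a::order set \<Rightarrow> 'b::order set \<Rightarrow> ('a \<rightharpoonup> 'b) \<Rightarrow> bool" where
  "extremizable X R \<psi> \<longleftrightarrow>
     (\<exists>l \<in> extensions X R \<psi>. \<exists>u \<in> extensions X R \<psi>. \<forall>f \<in> extensions X R \<psi>. l \<le> f \<and> f \<le> u)"

text \<open>The following four notions are meaningful only for extremizable \<open>\<psi>\<close>.\<close>

definition lex_ext :: "'a::order set \<Rightarrow> 'b::order set \<Rightarrow> ('a \<rightharpoonup> 'b) \<Rightarrow> 'a \<Rightarrow> 'b" where
  "lex_ext X R \<psi> = (LEAST f. f \<in> extensions X R \<psi>)"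

definition uex_ext :: "'a::order set \<Rightarrow> 'b::order set \<Rightarrow> ('a \<rightharpoonup> 'b) \<Rightarrow> 'a \<Rightarrow> 'b" where
  "uex_ext X R \<psi> = (GREATEST f. f \<in> extensions X R \<psi>)"

definition Dar :: "'a::order set \<Rightarrow> 'b::order set \<Rightarrow> ('a \<rightharpoonup> 'b) \<Rightarrow> 'a set" where
  "Dar X R \<psi> = {x \<in> X. lex_ext X R \<psi> x = uex_ext X R \<psi> x}"

definition BDar :: "'a::order set \<Rightarrow> 'b::order set \<Rightarrow> ('a \<rightharpoonup> 'b) \<Rightarrow> 'a set" where
  "BDar X R \<psi> = {x \<in> Dar X R \<psi>. \<exists>y \<in> dom \<psi>. \<exists>z \<in> dom \<psi>. y \<le> x \<and> x \<le> z}"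

definition Darboux_complete :: "'a::order set \<Rightarrow> bool" where
  "Darboux_complete P \<longleftrightarrow>
     (\<forall>\<psi>. partial_function_on (hat P) (hat P) \<psi> \<longrightarrow> extremizable (hat P) (hat P) \<psi>)"

definition id_partial :: "'a set \<Rightarrow> 'a \<rightharpoonup> 'a" where
  "id_partial A = Some |` A"

lemma extensional_le_iff:
  fixes f g :: "'a \<Rightarrow> 'b::order"
  assumes "f \<in> extensional X" "g \<in> extensional X"
  shows "f \<le> g \<longleftrightarrow> (\<forall>x\<in>X. f x \<le> g x)"
  using assms unfolding le_fun_def extensional_def
  by (metis (mono_tags, lifting) mem_Collect_eq order_refl)

lemma monoid_OP_monoid: "monoid (OP_monoid Q)"
proof (rule monoidI)
  fix f g assume "f \<in> carrier (OP_monoid Q)" "g \<in> carrier (OP_monoid Q)"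
  then show "f \<otimes>\<^bsub>OP_monoid Q\<^esub> g \<in> carrier (OP_monoid Q)"
    by (auto simp: OP_monoid_def OP_def compose_def PiE_mem intro!: mono_onI dest: mono_onD)
next
  fix f g h
  assume "f \<in> carrier (OP_monoid Q)" "g \<in> carrier (OP_monoid Q)" "h \<in> carrier (OP_monoid Q)"
  then show "f \<otimes>\<^bsub>OP_monoid Q\<^esub> g \<otimes>\<^bsub>OP_monoid Q\<^esub> h
           = f \<otimes>\<^bsub>OP_monoid Q\<^esub> (g \<otimes>\<^bsub>OP_monoid Q\<^esub> h)"
    by (auto simp: OP_monoid_def OP_def compose_def PiE_mem fun_eq_iff)
next
  show "\<one>\<^bsub>OP_monoid Q\<^esub> \<in> carrier (OP_monoid Q)"
    by (auto simp: OP_monoid_def OP_def mono_on_def)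
next
  fix f assume "f \<in> carrier (OP_monoid Q)"
  then show "\<one>\<^bsub>OP_monoid Q\<^esub> \<otimes>\<^bsub>OP_monoid Q\<^esub> f = f"
    and "f \<otimes>\<^bsub>OP_monoid Q\<^esub> \<one>\<^bsub>OP_monoid Q\<^esub> = f"
    by (auto simp: OP_monoid_def OP_def PiE_def intro: Id_compose compose_Id)
qed

lemma lex_uex_extremal:
  assumes "extremizable X R \<psi>"
  shows "lex_ext X R \<psi> \<in> extensions X R \<psi>" "uex_ext X R \<psi> \<in> extensions X R \<psi>"
    and "f \<in> extensions X R \<psi> \<Longrightarrow> lex_ext X R \<psi> \<le> f"
    and "f \<in> extensions X R \<psi> \<Longrightarrow> f \<le> uex_ext X R \<psi>"
proof -
  obtain l u where *: "l \<in> extensions X R \<psi>" "u \<in> extensions X R \<psi>"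
    "\<And>f. f \<in> extensions X R \<psi> \<Longrightarrow> l \<le> f \<and> f \<le> u"
    using assms unfolding extremizable_def by blast
  have "lex_ext X R \<psi> = l" "uex_ext X R \<psi> = u"
    unfolding lex_ext_def uex_ext_def using * by (auto intro: Least_equality Greatest_equality)
  with * show "lex_ext X R \<psi> \<in> extensions X R \<psi>" "uex_ext X R \<psi> \<in> extensions X R \<psi>"
    and "f \<in> extensions X R \<psi> \<Longrightarrow> lex_ext X R \<psi> \<le> f"
    and "f \<in> extensions X R \<psi> \<Longrightarrow> f \<le> uex_ext X R \<psi>" by auto
qed

end

theory Submission
  imports Defs "HOL-Algebra.Coset"
begin

text \<open>
A Darboux complete \<open>P\<close> makes \<open>Q = hat P\<close> a complete lattice: the least extension of the identity on
a down-closed set takes the supremum of that set as its value at \<open>+\<infinity>\<close>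
(\<open>Darboux_complete_imp_complete\<close>). Then \<open>OP Q\<close> is a complete lattice with pointwise suprema, and the
extreme extensions of \<open>id\<^sub>A\<close> send \<open>f\<close> to the supremum of the elements of \<open>A\<close> below \<open>f\<close> and to the
infimum of those above. So \<open>BDar(id\<^sub>A)\<close> consists of the \<open>f\<close> that are, pointwise, both the supremum of
a nonempty set of \<open>a \<in> A\<close> below \<open>f\<close> and the infimum of a nonempty set of \<open>b \<in> A\<close> above \<open>f\<close>
(\<open>BDar_id_partial_iff\<close>). It plays the role of a Dedekind completion of \<open>A\<close>.

Closure under products holds because the elements of \<open>A\<close> are automorphisms of \<open>Q\<close> and preserve
suprema and infima (\<open>approximable_compose\<close>). The candidate for the inverse of \<open>f\<close> is the pointwise
infimum \<open>g\<close> of the \<open>a\<inverse>\<close>. That \<open>f g = id\<close> is immediate, since pointwise suprema are compatible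
with composition on the right. Composition on the left is not symmetric to this: \<open>g f\<close> is the infimum of
the \<open>a\<inverse> b\<close>, while \<open>f g\<close> is the infimum of the \<open>b a\<inverse>\<close>. This is where complete integral closedness enters:
it forces positive elements of \<open>A\<close> to commute, and then \<open>a\<inverse> b\<close> is a conjugate of \<open>b a\<inverse>\<close> by an element
that does not depend on \<open>a\<close> and \<open>b\<close> (\<open>inv_mult_conj\<close>, \<open>B_inverse\<close>).

That a directed completely integrally closed group is commutative is usually deduced from the theorem
for complete lattice ordered groups. The proof given here stays inside the group. For \<open>w\<close> that is not
\<open>\<le> \<one>\<close>, comparing elements only on the support of the positive part of \<open>w\<close> gives a coarser preorder
that is again completely integrally closed and in which \<open>w \<ge> \<one>\<close> but not \<open>w \<le> \<one>\<close> (\<open>local_order\<close>). So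
any failing inequality can be reversed locally (\<open>reverse_locally\<close>), and one can argue as in a totally
ordered group: first \<open>x z x\<inverse> \<le> z\<^sup>2\<close> for positive \<open>x\<close> and \<open>z\<close>, then, for a commutator \<open>z\<close> of positive
\<open>x\<close> and \<open>y\<close>, that \<open>z\<^sup>n \<le> y\<close> for all \<open>n\<close>, whence \<open>z \<le> \<one>\<close>.
\<close>

section \<open>Preordered groups\<close>

text \<open>
A preorder rather than an order, because the commutativity proof repeatedly passes to a coarser
relation. This is the order of a quotient of the group, kept on the group itself.
\<close>

locale preordered_group = group G for G (structure) +
  fixes le :: "'a \<Rightarrow> 'a \<Rightarrow> bool" (infix "\<preceq>" 50)
  assumes le_refl [simp, intro]: "x \<in> carrier G \<Longrightarrow> x \<preceq> x"
    and le_trans [trans]: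
      "\<lbrakk>x \<preceq> y; y \<preceq> z; x \<in> carrier G; y \<in> carrier G; z \<in> carrier G\<rbrakk> \<Longrightarrow> x \<preceq> z"
    and le_mult_left:
      "\<lbrakk>x \<preceq> y; x \<in> carrier G; y \<in> carrier G; z \<in> carrier G\<rbrakk> \<Longrightarrow> z \<otimes> x \<preceq> z \<otimes> y"
    and le_mult_right:
      "\<lbrakk>x \<preceq> y; x \<in> carrier G; y \<in> carrier G; z \<in> carrier G\<rbrakk> \<Longrightarrow> x \<otimes> z \<preceq> y \<otimes> z"

locale cic_preordered_group = preordered_group +
  assumes directed: "x \<in> carrier G \<Longrightarrow> \<exists>u\<in>carrier G. \<one> \<preceq> u \<and> x \<preceq> u"
    and cic: "\<lbrakk>c \<in> carrier G; d \<in> carrier G; \<And>n::nat. c [^] n \<preceq> d\<rbrakk> \<Longrightarrow> c \<preceq> \<one>"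

context group
begin

lemma mult_inv_cancel [simp]:
  assumes "x \<in> carrier G" "y \<in> carrier G"
  shows "inv x \<otimes> (x \<otimes> y) = y" "x \<otimes> (inv x \<otimes> y) = y"
  using assms by (simp_all flip: m_assoc)

lemma conj_pow:
  assumes "h \<in> carrier G" "c \<in> carrier G"
  shows "(h \<otimes> c \<otimes> inv h) [^] (n::nat) = h \<otimes> c [^] n \<otimes> inv h"
  using assms by (induction n) (simp_all add: m_assoc)

end

context preordered_group
begin

lemma le_mult:
  assumes "x \<preceq> y" "x' \<preceq> y'" "x \<in> carrier G" "y \<in> carrier G" "x' \<in> carrier G" "y' \<in> carrier G"
  shows "x \<otimes> x' \<preceq> y \<otimes> y'"
  using le_trans[OF le_mult_right[of x y x'] le_mult_left[of x' y' y]] assms by simp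

lemma inv_mult_le_iff:
  assumes "c \<in> carrier G" "x \<in> carrier G" "y \<in> carrier G"
  shows "inv x \<otimes> c \<preceq> y \<longleftrightarrow> c \<preceq> x \<otimes> y"
  using le_mult_left[of "inv x \<otimes> c" y x] le_mult_left[of c "x \<otimes> y" "inv x"] assms by auto

lemma mult_inv_le_iff:
  assumes "c \<in> carrier G" "x \<in> carrier G" "y \<in> carrier G"
  shows "c \<otimes> inv y \<preceq> x \<longleftrightarrow> c \<preceq> x \<otimes> y"
  using le_mult_right[of "c \<otimes> inv y" x y] le_mult_right[of c "x \<otimes> y" "inv y"] assms
  by (auto simp: m_assoc)

lemma le_mult_pos:
  assumes "x \<in> carrier G" "u \<in> carrier G" "\<one> \<preceq> u"
  shows "x \<preceq> u \<otimes> x" "x \<preceq> x \<otimes> u"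
  using le_mult_right[of \<one> u x] le_mult_left[of \<one> u x] assms by auto

lemma mult_inv_pos_le:
  assumes "x \<in> carrier G" "u \<in> carrier G" "\<one> \<preceq> u"
  shows "inv u \<otimes> x \<preceq> x" "x \<otimes> inv u \<preceq> x"
  using assms by (simp_all add: inv_mult_le_iff mult_inv_le_iff le_mult_pos)

lemma pow_mono:
  assumes "x \<preceq> y" "x \<in> carrier G" "y \<in> carrier G"
  shows "x [^] (n::nat) \<preceq> y [^] n"
  using assms by (induction n) (auto intro: le_mult)

lemma one_le_pow:
  assumes "x \<in> carrier G" "\<one> \<preceq> x"
  shows "\<one> \<preceq> x [^] (n::nat)"
  using pow_mono[of \<one> x n] assms by simp

lemma pow_le_pow:
  assumes "x \<in> carrier G" "\<one> \<preceq> x" "m \<le> n"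
  shows "x [^] (m::nat) \<preceq> x [^] n"
proof -
  have "x [^] n = x [^] m \<otimes> x [^] (n - m)"
    using assms by (simp add: nat_pow_mult)
  then show ?thesis
    using le_mult_pos(2)[of "x [^] m" "x [^] (n - m)"] one_le_pow[of x "n - m"] assms by simp
qed

definition pos :: "'a set" where
  "pos = {u \<in> carrier G. \<one> \<preceq> u}"

lemma posD [dest]: "u \<in> pos \<Longrightarrow> u \<in> carrier G" "u \<in> pos \<Longrightarrow> \<one> \<preceq> u"
  by (auto simp: pos_def)

lemma one_pos [simp]: "\<one> \<in> pos"
  by (simp add: pos_def)

lemma mult_pos: "\<lbrakk>u \<in> pos; v \<in> pos\<rbrakk> \<Longrightarrow> u \<otimes> v \<in> pos"
  using le_mult[of \<one> u \<one> v] by (auto simp: pos_def)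

lemma conj_pos: "\<lbrakk>u \<in> pos; h \<in> carrier G\<rbrakk> \<Longrightarrow> h \<otimes> u \<otimes> inv h \<in> pos"
  using le_mult_left[of \<one> u h] mult_inv_le_iff[of \<one> _ h]
  using le_mult_right[OF le_mult_left[of \<one> u h], of "inv h"]
  by (auto simp: pos_def)

end

section \<open>Disjoint positive parts\<close>

context cic_preordered_group
begin

text \<open>
In a lattice ordered group, \<open>upper p\<close> would be the set of elements above the positive part
\<open>p\<^sup>+\<close>. There need not be a least such element here, so the whole set stands in for
\<open>p\<^sup>+\<close>, and \<open>disjoint (upper p) (upper q)\<close> stands in for \<open>p\<^sup>+ \<and> q\<^sup>+ = \<one>\<close>.
\<close>

definition upper :: "'a \<Rightarrow> 'a set" where
  "upper p = {u \<in> pos. p \<preceq> u}"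

definition disjoint :: "'a set \<Rightarrow> 'a set \<Rightarrow> bool" where
  "disjoint X Y \<longleftrightarrow> (\<forall>c\<in>carrier G. (\<forall>x\<in>X \<union> Y. c \<preceq> x) \<longrightarrow> c \<preceq> \<one>)"

lemma disjointD: "\<lbrakk>disjoint X Y; c \<in> carrier G; \<And>x. x \<in> X \<Longrightarrow> c \<preceq> x; \<And>y. y \<in> Y \<Longrightarrow> c \<preceq> y\<rbrakk> \<Longrightarrow> c \<preceq> \<one>"
  by (auto simp: disjoint_def)

lemma disjoint_sym: "disjoint X Y \<Longrightarrow> disjoint Y X"
  by (auto simp: disjoint_def)

lemma disjoint_mono: "\<lbrakk>disjoint X Y; X \<subseteq> X'\<rbrakk> \<Longrightarrow> disjoint X' Y"
  by (auto simp: disjoint_def)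

lemma upper_subset_pos: "upper p \<subseteq> pos"
  by (auto simp: upper_def)

lemma upperD [dest]: "u \<in> upper p \<Longrightarrow> u \<in> carrier G" "u \<in> upper p \<Longrightarrow> \<one> \<preceq> u" "u \<in> upper p \<Longrightarrow> p \<preceq> u"
  by (auto simp: upper_def)

lemma upperI: "\<lbrakk>u \<in> carrier G; \<one> \<preceq> u; p \<preceq> u\<rbrakk> \<Longrightarrow> u \<in> upper p"
  by (auto simp: upper_def pos_def)

lemma upper_antimono: "\<lbrakk>q \<preceq> p; q \<in> carrier G; p \<in> carrier G\<rbrakk> \<Longrightarrow> upper p \<subseteq> upper q"
  by (auto simp: upper_def intro: le_trans[of q p])

lemma set_mult_subset_pos: "\<lbrakk>X \<subseteq> pos; Y \<subseteq> pos\<rbrakk> \<Longrightarrow> X <#> Y \<subseteq> pos"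
  by (auto simp: set_mult_def intro!: mult_pos)

text \<open>
If \<open>c\<close> is below all \<open>x y\<close> and below \<open>W\<close>, then for each fixed \<open>y\<close> the element \<open>c y\<inverse>\<close> is below
\<open>X\<close>, and below \<open>W\<close> because \<open>y\<close> is positive; so \<open>c \<le> y\<close>, and \<open>c\<close> is below \<open>Y\<close> as well.
\<close>

lemma disjoint_set_mult:
  assumes XW: "disjoint X W" and YW: "disjoint Y W"
    and X: "X \<subseteq> pos" and Y: "Y \<subseteq> pos" and W: "W \<subseteq> pos"
  shows "disjoint (X <#> Y) W"
  unfolding disjoint_def
proof (intro ballI impI)
  fix c assume c: "c \<in> carrier G" and le: "\<forall>v\<in>(X <#> Y) \<union> W. c \<preceq> v"
  show "c \<preceq> \<one>"
  proof (rule disjointD[OF YW c])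
    fix y assume y: "y \<in> Y"
    then have yG: "y \<in> carrier G" "\<one> \<preceq> y" using Y by auto
    have "c \<otimes> inv y \<preceq> \<one>"
    proof (rule disjointD[OF XW])
      show "c \<otimes> inv y \<in> carrier G" using c yG by simp
      fix x assume "x \<in> X"
      with y have "c \<preceq> x \<otimes> y" using le by (auto simp: set_mult_def)
      then show "c \<otimes> inv y \<preceq> x" using c yG X \<open>x \<in> X\<close> by (subst mult_inv_le_iff) auto
    next
      fix w assume "w \<in> W"
      then have w: "w \<in> carrier G" "c \<preceq> w" using le W by auto
      show "c \<otimes> inv y \<preceq> w"
        by (rule le_trans[OF mult_inv_pos_le(2)]) (use c yG w in auto)
    qed
    then show "c \<preceq> y" using c yG by (simp add: mult_inv_le_iff)
  qed (use le in auto)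
qed

definition set_power :: "'a set \<Rightarrow> nat \<Rightarrow> 'a set" where
  "set_power X n = ((\<lambda>Y. X <#> Y) ^^ n) {\<one>}"

lemma set_power_simps [simp]:
  "set_power X 0 = {\<one>}" "set_power X (Suc n) = X <#> set_power X n"
  by (simp_all add: set_power_def)

lemma set_power_subset_pos: "X \<subseteq> pos \<Longrightarrow> set_power X n \<subseteq> pos"
  by (induction n) (simp_all add: set_mult_subset_pos)

lemma disjoint_set_power:
  assumes "disjoint X W" "X \<subseteq> pos" "W \<subseteq> pos"
  shows "disjoint (set_power X n) W"
proof (induction n)
  case 0
  show ?case by (simp add: disjoint_def)
next
  case (Suc n)
  then show ?case
    using disjoint_set_mult[OF assms(1) Suc] set_power_subset_pos assms by simp
qed

lemma pow_le_set_power: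
  assumes "c \<in> carrier G" "X \<subseteq> pos" "\<And>x. x \<in> X \<Longrightarrow> c \<preceq> x" "y \<in> set_power X n"
  shows "c [^] n \<preceq> y"
  using assms(4)
proof (induction n arbitrary: y)
  case (Suc n)
  then obtain x v where "x \<in> X" "v \<in> set_power X n" "y = x \<otimes> v"
    by (auto simp: set_mult_def)
  moreover have "x \<in> carrier G" "v \<in> carrier G"
    using calculation set_power_subset_pos[OF assms(2), of n] assms(2) by auto
  ultimately show ?case
    using Suc.IH assms(1,3) le_mult[of c x "c [^] n" v] nat_pow_Suc2[of c n] by simp
qed (simp)

text \<open>
Take \<open>h \<ge> \<one>\<close> and \<open>c\<close> below \<open>W\<close> with \<open>h\<inverse> c h\<close> below \<open>upper p\<close>. Then \<open>h\<inverse> c\<^sup>n\<close> is below the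
\<open>n\<close>-fold products of \<open>upper p\<close> and also below those of \<open>W\<close>, which are still disjoint. Hence
\<open>c\<^sup>n \<le> h\<close> for all \<open>n\<close>, and complete integral closedness gives \<open>c \<le> \<one>\<close>. The case
\<open>h\<inverse> \<ge> \<one>\<close> is symmetric.
\<close>

lemma disjoint_conj_aux:
  assumes dis: "disjoint (upper p) W" and W: "W \<subseteq> pos"
    and p: "p \<in> carrier G" and h: "h \<in> carrier G" and one_h: "\<one> \<preceq> h \<or> \<one> \<preceq> inv h"
  shows "disjoint (upper (h \<otimes> p \<otimes> inv h)) W"
  unfolding disjoint_def
proof (intro ballI impI)
  fix c assume c: "c \<in> carrier G" and le: "\<forall>v\<in>upper (h \<otimes> p \<otimes> inv h) \<union> W. c \<preceq> v"
  let ?c = "inv h \<otimes> c \<otimes> h"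
  have c_le: "?c \<preceq> u" if "u \<in> upper p" for u
  proof -
    have u: "u \<in> carrier G" "\<one> \<preceq> u" "p \<preceq> u" using that by auto
    have "h \<otimes> u \<otimes> inv h \<in> upper (h \<otimes> p \<otimes> inv h)"
      using u p h conj_pos[of u h]
      by (auto simp: upper_def pos_def intro!: le_mult_left le_mult_right)
    then have "c \<preceq> h \<otimes> u \<otimes> inv h" using le by auto
    then show ?thesis
      using c u h le_mult_right[of "inv h \<otimes> c" "u \<otimes> inv h" h]
      by (auto simp: inv_mult_le_iff m_assoc)
  qed
  have pow: "?c [^] n = inv h \<otimes> c [^] n \<otimes> h" for n :: nat
    using conj_pow[of "inv h" c n] c h by simp
  have low: "inv h \<otimes> c [^] n \<otimes> h \<preceq> v" if "v \<in> set_power (upper p) n" for v n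
    using pow_le_set_power[of ?c "upper p" v n] c_le that c h upper_subset_pos pow by auto
  have lowW: "c [^] n \<preceq> v" if "v \<in> set_power W n" for v n
    using pow_le_set_power[of c W v n] le that c W by auto
  have dis_n: "disjoint (set_power (upper p) n) (set_power W n)" for n
    by (intro disjoint_set_power disjoint_sym[OF disjoint_set_power] disjoint_sym[OF dis]
          set_power_subset_pos W upper_subset_pos)
  have cG: "c [^] n \<in> carrier G" for n :: nat using c by simp
  have posG: "v \<in> carrier G" if "v \<in> set_power (upper p) n \<union> set_power W n" for v n
    using that set_power_subset_pos[OF upper_subset_pos, of p n] set_power_subset_pos[OF W, of n] by auto
  from one_h show "c \<preceq> \<one>"
  proof
    assume one_h: "\<one> \<preceq> h"
    have "inv h \<otimes> c [^] n \<preceq> \<one>" for n :: nat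
    proof (rule disjointD[OF dis_n[of n]])
      show "inv h \<otimes> c [^] n \<in> carrier G" using c h by simp
      fix v assume "v \<in> set_power (upper p) n"
      then show "inv h \<otimes> c [^] n \<preceq> v"
        using le_trans[OF le_mult_pos(2)[of "inv h \<otimes> c [^] n" h] low[of v n]] posG c h one_h
        by auto
    next
      fix v assume "v \<in> set_power W n"
      then show "inv h \<otimes> c [^] n \<preceq> v"
        using le_trans[OF mult_inv_pos_le(1)[of "c [^] n" h] lowW[of v n]] posG c h one_h
        by auto
    qed
    then show ?thesis using cic[of c h] c h cG by (simp add: inv_mult_le_iff)
  next
    assume one_h: "\<one> \<preceq> inv h"
    have "c [^] n \<otimes> h \<preceq> \<one>" for n :: nat
    proof (rule disjointD[OF dis_n[of n]])
      show "c [^] n \<otimes> h \<in> carrier G" using c h by simp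
      fix v assume "v \<in> set_power (upper p) n"
      then show "c [^] n \<otimes> h \<preceq> v"
        using le_trans[OF le_mult_pos(1)[of "c [^] n \<otimes> h" "inv h"], of v] low[of v n] posG c h one_h
        by (auto simp: m_assoc)
    next
      fix v assume "v \<in> set_power W n"
      then show "c [^] n \<otimes> h \<preceq> v"
        using le_trans[OF mult_inv_pos_le(2)[of "c [^] n" "inv h"] lowW[of v n]] posG c h one_h
        by auto
    qed
    then show ?thesis using cic[of c "inv h"] c h cG mult_inv_le_iff[of _ \<one> "inv h"] by simp
  qed
qed

text \<open>
By directedness every \<open>h\<close> is the product of a positive element and the inverse of a positive one.
This makes the local orders below invariant under multiplication from both sides.
\<close>

lemma disjoint_conj:
  assumes dis: "disjoint (upper p) W" and W: "W \<subseteq> pos"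
    and p: "p \<in> carrier G" and h: "h \<in> carrier G"
  shows "disjoint (upper (h \<otimes> p \<otimes> inv h)) W"
proof -
  obtain u where u: "u \<in> carrier G" "\<one> \<preceq> u" "h \<preceq> u" using directed[OF h] by blast
  define k where "k = inv u \<otimes> h"
  have k: "k \<in> carrier G" "h = u \<otimes> k" using u h by (auto simp: k_def)
  have "k \<preceq> \<one>" using u h by (simp add: k_def inv_mult_le_iff)
  then have "\<one> \<preceq> inv k" using le_mult_left[of k \<one> "inv k"] k by simp
  then have "disjoint (upper (k \<otimes> p \<otimes> inv k)) W"
    using disjoint_conj_aux[OF dis W p] k by auto
  then have "disjoint (upper (u \<otimes> (k \<otimes> p \<otimes> inv k) \<otimes> inv u)) W"
    using disjoint_conj_aux[OF _ W, of "k \<otimes> p \<otimes> inv k" u] k p u by auto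
  then show ?thesis using k u p by (simp add: m_assoc inv_mult_group)
qed

text \<open>
A substitute for the formula \<open>(p\<^sup>+)\<^sup>n = \<one> \<or> p \<or> \<dots> \<or> p\<^sup>n\<close> of lattice ordered groups: the element \<open>c\<close>
plays the role of an element below \<open>p\<^sup>+\<close>.
\<close>

lemma pow_le_upper_powers:
  assumes c: "c \<in> carrier G" and p: "p \<in> carrier G" and le: "\<And>u. u \<in> upper p \<Longrightarrow> c \<preceq> u"
    and v: "v \<in> carrier G" "\<And>k::nat. k \<le> n \<Longrightarrow> p [^] k \<preceq> v"
  shows "c [^] n \<preceq> v"
  using v
proof (induction n arbitrary: v)
  case 0
  then show ?case using "0.prems"(2)[of 0] by simp
next
  case (Suc n)
  have "c [^] n \<preceq> v \<otimes> inv p"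
  proof (rule Suc.IH)
    fix k :: nat assume "k \<le> n"
    then have "p [^] k \<otimes> p \<preceq> v" using Suc.prems(2)[of "Suc k"] by simp
    then show "p [^] k \<preceq> v \<otimes> inv p"
      using mult_inv_le_iff[of "p [^] k" v "inv p"] p Suc.prems(1) by simp
  qed (use Suc.prems p in simp)
  then have "c [^] n \<otimes> p \<preceq> v"
    using mult_inv_le_iff[of "c [^] n" v "inv p"] c p Suc.prems(1) by simp
  then have "p \<preceq> inv (c [^] n) \<otimes> v"
    using inv_mult_le_iff[of p "inv (c [^] n)" v] c p Suc.prems(1) by simp
  moreover have "c [^] n \<preceq> v" using Suc by simp
  then have "\<one> \<preceq> inv (c [^] n) \<otimes> v"
    using inv_mult_le_iff[of \<one> "inv (c [^] n)" v] c Suc.prems(1) by simp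
  ultimately have "c \<preceq> inv (c [^] n) \<otimes> v"
    using c Suc.prems(1) by (auto intro!: upperI le)
  then show ?case
    using inv_mult_le_iff[of c "inv (c [^] n)" v] c Suc.prems(1) by simp
qed

lemma disjoint_upper_one: "disjoint (upper \<one>) W"
  by (auto simp: disjoint_def upper_def)

text \<open>
The positive and the negative part of \<open>w\<close> are disjoint: if \<open>c\<close> is below both, then multiplication
by \<open>c\<inverse>\<close> maps \<open>upper w\<close> into itself, so a single \<open>u\<close> in it bounds all powers of \<open>c\<close>.
\<close>

lemma disjoint_inv:
  assumes w: "w \<in> carrier G"
  shows "disjoint (upper (inv w)) (upper w)"
  unfolding disjoint_def
proof (intro ballI impI)
  fix c assume c: "c \<in> carrier G" and le: "\<forall>v\<in>upper (inv w) \<union> upper w. c \<preceq> v"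
  have step: "u \<otimes> inv c \<in> upper w" if u: "u \<in> upper w" for u
  proof (rule upperI)
    have uG: "u \<in> carrier G" using u by auto
    then show "u \<otimes> inv c \<in> carrier G" using c by simp
    show "\<one> \<preceq> u \<otimes> inv c"
      using le u c uG mult_inv_le_iff[of \<one> u "inv c"] by auto
    have "inv w \<otimes> u \<in> upper (inv w)"
      using u uG w le_mult_left[of \<one> u "inv w"] inv_mult_le_iff[of \<one> "inv w" u]
        le_mult_left[of w u "inv w"]
      by (auto intro!: upperI)
    then have "c \<preceq> inv w \<otimes> u" using le by auto
    then show "w \<preceq> u \<otimes> inv c"
      using c w uG inv_mult_le_iff[of c "inv w" u] mult_inv_le_iff[of w u "inv c"] by simp
  qed
  obtain u where u: "u \<in> upper w" using directed[OF w] by (auto intro: upperI)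
  have "u \<otimes> inv (c [^] n) \<in> upper w" for n :: nat
  proof (induction n)
    case (Suc n)
    then show ?case
      using step[OF Suc] u c nat_pow_Suc2[of c n] by (auto simp: inv_mult_group m_assoc)
  qed (use u upperD(1)[OF u] in simp)
  then have "c [^] n \<preceq> u" for n :: nat
    using mult_inv_le_iff[of \<one> u "inv (c [^] n)"] c u by auto
  then show "c \<preceq> \<one>" using cic c u by blast
qed

section \<open>Reversing an order locally\<close>

lemma local_order_coarser:
  assumes "x \<preceq> y" "x \<in> carrier G" "y \<in> carrier G"
  shows "disjoint (upper (x \<otimes> inv y)) (upper w)"
  using disjoint_mono[OF disjoint_upper_one upper_antimono[of "x \<otimes> inv y" \<one>]] assms
  by (auto simp: mult_inv_le_iff)

text \<open>
The relation says that \<open>x y\<inverse>\<close> has a positive part disjoint from that of \<open>w\<close>, that is, \<open>x \<le> y\<close>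
holds modulo the elements disjoint from the positive part of \<open>w\<close>; it compares \<open>x\<close> and \<open>y\<close> only
where \<open>w > \<one>\<close>. The axiom that needs work is complete integral closedness.
\<close>

lemma local_order:
  assumes w: "w \<in> carrier G"
  shows "cic_preordered_group G (\<lambda>x y. disjoint (upper (x \<otimes> inv y)) (upper w))"
    (is "cic_preordered_group G ?le")
proof unfold_locales
  let ?W = "upper w"
  have W: "?W \<subseteq> pos" by (rule upper_subset_pos)
  note coarser = local_order_coarser[where w = w]
  show "?le x x" if "x \<in> carrier G" for x
    using coarser[of x x] that by simp
  show trans: "?le x z" if "?le x y" "?le y z" "x \<in> carrier G" "y \<in> carrier G" "z \<in> carrier G" for x y z
  proof (rule disjoint_mono)
    show "disjoint (upper (x \<otimes> inv y) <#> upper (y \<otimes> inv z)) ?W"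
      using disjoint_set_mult that W upper_subset_pos by blast
    show "upper (x \<otimes> inv y) <#> upper (y \<otimes> inv z) \<subseteq> upper (x \<otimes> inv z)"
    proof
      fix v assume "v \<in> upper (x \<otimes> inv y) <#> upper (y \<otimes> inv z)"
      then obtain s t where st: "s \<in> upper (x \<otimes> inv y)" "t \<in> upper (y \<otimes> inv z)" "v = s \<otimes> t"
        by (auto simp: set_mult_def)
      then have "(x \<otimes> inv y) \<otimes> (y \<otimes> inv z) \<preceq> v"
        using that by (auto intro!: le_mult)
      then show "v \<in> upper (x \<otimes> inv z)"
        using st that mult_pos[of s t] by (auto simp: m_assoc upper_def)
    qed
  qed
  show "?le (z \<otimes> x) (z \<otimes> y)" if "?le x y" "x \<in> carrier G" "y \<in> carrier G" "z \<in> carrier G" for x y z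
    using disjoint_conj[OF that(1) W, of z] that by (simp add: m_assoc inv_mult_group)
  show "?le (x \<otimes> z) (y \<otimes> z)" if "?le x y" "x \<in> carrier G" "y \<in> carrier G" "z \<in> carrier G" for x y z
    using that by (simp add: m_assoc inv_mult_group)
  show "\<exists>u\<in>carrier G. ?le \<one> u \<and> ?le x u" if "x \<in> carrier G" for x
    using directed[OF that] coarser that by (metis one_closed)
  fix p d assume p: "p \<in> carrier G" and d: "d \<in> carrier G" and le: "\<And>n::nat. ?le (p [^] n) d"
  obtain e where e: "e \<in> carrier G" "\<one> \<preceq> e" "d \<preceq> e" using directed[OF d] by blast
  have le_e: "?le (p [^] n) e" for n :: nat
    using trans[OF le coarser[OF e(3)]] p d e by simp
  have "disjoint (upper p) ?W"
    unfolding disjoint_def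
  proof (intro ballI impI)
    fix c assume c: "c \<in> carrier G" and cle: "\<forall>v\<in>upper p \<union> ?W. c \<preceq> v"
    \<comment> \<open>Each \<open>p\<^sup>k e\<inverse>\<close> has positive part disjoint from that of \<open>w\<close>; products bound finitely many of them at once.\<close>
    have bound: "\<exists>T\<subseteq>pos. disjoint T ?W \<and> (\<forall>u\<in>T. \<forall>k<n. p [^] k \<otimes> inv e \<preceq> u)" for n :: nat
    proof (induction n)
      case 0
      show ?case by (intro exI[of _ "{\<one>}"]) (simp add: disjoint_def)
    next
      case (Suc n)
      then obtain T where T: "T \<subseteq> pos" "disjoint T ?W" "\<forall>u\<in>T. \<forall>k<n. p [^] k \<otimes> inv e \<preceq> u" by blast
      let ?T = "upper (p [^] n \<otimes> inv e) <#> T"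
      have "p [^] k \<otimes> inv e \<preceq> u" if u: "u \<in> ?T" and k: "k < Suc n" for u k
      proof -
        obtain s t where st: "s \<in> upper (p [^] n \<otimes> inv e)" "t \<in> T" "u = s \<otimes> t"
          using u by (auto simp: set_mult_def)
        then have stG: "s \<in> carrier G" "t \<in> carrier G" "\<one> \<preceq> s" "\<one> \<preceq> t" using T by auto
        have "p [^] k \<otimes> inv e \<preceq> s \<or> p [^] k \<otimes> inv e \<preceq> t"
          using st T(3) k by (cases "k = n") auto
        then show ?thesis
          using le_trans[OF _ le_mult_pos(1)[of t s]] le_trans[OF _ le_mult_pos(2)[of s t]] stG st(3) p e
          by auto
      qed
      moreover have "disjoint ?T ?W"
        by (rule disjoint_set_mult) (use T W le_e upper_subset_pos in auto)
      ultimately show ?case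
        using set_mult_subset_pos[OF upper_subset_pos T(1)] by blast
    qed
    have "c [^] n \<preceq> e" for n :: nat
    proof -
      obtain T where T: "T \<subseteq> pos" "disjoint T ?W" "\<forall>u\<in>T. \<forall>k<Suc n. p [^] k \<otimes> inv e \<preceq> u"
        using bound[of "Suc n"] by blast
      \<comment> \<open>\<open>c\<^sup>n\<close> is below \<open>v e\<close> for all \<open>v\<close> in \<open>T\<close> and, as \<open>e\<close> is positive, for all \<open>n\<close>-fold products \<open>v\<close> from \<open>upper w\<close>.\<close>
      have "c [^] n \<otimes> inv e \<preceq> \<one>"
      proof (rule disjointD)
        show "disjoint T (set_power ?W n)"
          using disjoint_sym[OF disjoint_set_power[OF disjoint_sym[OF T(2)]]] W T(1) by blast
        show "c [^] n \<otimes> inv e \<in> carrier G" using c e by simp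
        fix v
        {
          assume "v \<in> T"
          then have v: "v \<in> carrier G" using T by auto
          have "c [^] n \<preceq> v \<otimes> e"
            by (rule pow_le_upper_powers[OF c p])
              (use cle T \<open>v \<in> T\<close> v e p in \<open>auto simp: less_Suc_eq_le simp flip: mult_inv_le_iff\<close>)
          then show "c [^] n \<otimes> inv e \<preceq> v" using c e v by (simp add: mult_inv_le_iff)
        }
        assume v: "v \<in> set_power ?W n"
        then have "v \<in> carrier G" using set_power_subset_pos[OF W] by auto
        moreover have "c [^] n \<preceq> v"
          using pow_le_set_power[OF c W _ v] cle by auto
        ultimately show "c [^] n \<otimes> inv e \<preceq> v"
          using le_trans[OF mult_inv_pos_le(2)] c e by simp
      qed
      then show ?thesis using c e by (simp add: mult_inv_le_iff)
    qed
    then show "c \<preceq> \<one>" using cic c e by blast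
  qed
  then show "?le p \<one>" using p by simp
qed

text \<open>
The tool that replaces a total order: to prove \<open>s \<le> t\<close> by contradiction one may pass to a coarser
order in which \<open>t \<le> s\<close> holds but \<open>s \<le> t\<close> still fails.
\<close>

lemma reverse_locally:
  assumes s: "s \<in> carrier G" and t: "t \<in> carrier G" and "\<not> s \<preceq> t"
  obtains le' where "cic_preordered_group G le'"
    "\<And>x y. \<lbrakk>x \<preceq> y; x \<in> carrier G; y \<in> carrier G\<rbrakk> \<Longrightarrow> le' x y"
    "le' t s" "\<not> le' s t"
proof
  let ?w = "s \<otimes> inv t"
  let ?le = "\<lambda>x y. disjoint (upper (x \<otimes> inv y)) (upper ?w)"
  show "cic_preordered_group G ?le" using local_order s t by simp
  show "?le x y" if "x \<preceq> y" "x \<in> carrier G" "y \<in> carrier G" for x y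
    using local_order_coarser that by blast
  show "?le t s" using disjoint_inv[of ?w] s t by (simp add: inv_mult_group)
  have "\<not> ?w \<preceq> \<one>" using assms by (simp add: mult_inv_le_iff)
  then show "\<not> ?le s t" using s t by (auto simp: disjoint_def)
qed

section \<open>Commutativity of completely integrally closed groups\<close>

text \<open>
Iterating the hypothesis gives \<open>z\<^bsup>2^n\<^esup> \<le> x\<^sup>n z x\<^bsup>-n\<^esup> \<le> x\<^sup>n z\<close>: the left side grows exponentially and
the right side linearly. If \<open>z\<^sup>K \<le> x\<^sup>2\<close> failed for some \<open>K\<close>, then locally \<open>x\<^sup>2 \<le> z\<^sup>K\<close>, so
\<open>x\<^bsup>2n\<^esup> \<le> z\<^bsup>Kn\<^esup> \<le> x\<^sup>n z\<close> for large \<open>n\<close> and the powers of \<open>x\<close> would be bounded by \<open>z\<close>; so \<open>x\<close>, and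
with it \<open>z\<close>, would be trivial in the local order. Hence all powers of \<open>z\<close> are bounded by \<open>x\<^sup>2\<close>.
\<close>

lemma square_le_conj:
  assumes x: "x \<in> carrier G" "\<one> \<preceq> x" and z: "z \<in> carrier G" "\<one> \<preceq> z"
    and le: "z [^] (2::nat) \<preceq> x \<otimes> z \<otimes> inv x"
  shows "z \<preceq> \<one>"
proof -
  have "z [^] K \<preceq> x [^] (2::nat)" for K :: nat
  proof (rule ccontr)
    assume "\<not> z [^] K \<preceq> x [^] (2::nat)"
    then obtain le' where "cic_preordered_group G le'"
      and coarser: "\<And>x y. \<lbrakk>x \<preceq> y; x \<in> carrier G; y \<in> carrier G\<rbrakk> \<Longrightarrow> le' x y"
      and le': "le' (x [^] (2::nat)) (z [^] K)" "\<not> le' (z [^] K) (x [^] (2::nat))"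
      using reverse_locally[of "z [^] K" "x [^] (2::nat)"] x z by auto
    interpret L: cic_preordered_group G le' by fact
    have pos: "le' \<one> x" "le' \<one> z" using coarser x z by auto
    have growth: "z [^] ((2::nat) ^ n) \<preceq> x [^] n \<otimes> z \<otimes> inv (x [^] n)" for n
    proof (induction n)
      case (Suc n)
      have "z [^] ((2::nat) ^ Suc n) = (z [^] (2::nat)) [^] ((2::nat) ^ n)"
        using z by (simp add: nat_pow_pow mult.commute)
      also have "\<dots> \<preceq> (x \<otimes> z \<otimes> inv x) [^] ((2::nat) ^ n)"
        using pow_mono[OF le] x z by simp
      also have "\<dots> = x \<otimes> z [^] ((2::nat) ^ n) \<otimes> inv x"
        using conj_pow x z by simp
      also have "\<dots> \<preceq> x \<otimes> (x [^] n \<otimes> z \<otimes> inv (x [^] n)) \<otimes> inv x"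
        using Suc x z by (auto intro!: le_mult_left le_mult_right)
      also have "\<dots> = x [^] Suc n \<otimes> z \<otimes> inv (x [^] Suc n)"
        unfolding nat_pow_Suc2[OF x(1)] using x z by (simp add: m_assoc inv_mult_group)
      finally show ?case using x z by simp
    qed (use x z in simp)
    have small: "le' (x [^] n) z" if n: "K * n \<le> 2 ^ n" for n :: nat
    proof -
      have "(x [^] n) \<otimes> (x [^] n) = (x [^] (2::nat)) [^] n"
        using x by (simp add: nat_pow_pow nat_pow_mult mult_2)
      also have "le' \<dots> ((z [^] K) [^] n)"
        using L.pow_mono[OF le'(1)] x z by simp
      also have "(z [^] K) [^] n = z [^] (K * n)"
        using z by (simp add: nat_pow_pow)
      also have "le' \<dots> (z [^] ((2::nat) ^ n))"
        using L.pow_le_pow z pos n by simp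
      also have "le' \<dots> (x [^] n \<otimes> z \<otimes> inv (x [^] n))"
        using coarser growth x z by simp
      also have "le' \<dots> (x [^] n \<otimes> z)"
        using L.mult_inv_pos_le(2) L.one_le_pow x z pos by simp
      finally have "le' (x [^] n \<otimes> x [^] n) (x [^] n \<otimes> z)" using x z by simp
      then show ?thesis
        using L.inv_mult_le_iff[of "x [^] n \<otimes> x [^] n" "x [^] n" z] x z by simp
    qed
    have "le' (x [^] n) z" for n :: nat
    proof -
      \<comment> \<open>The exponent \<open>m = 2 p\<close> works, as \<open>2\<^sup>p \<ge> p\<close> and \<open>p \<ge> 2 K\<close>.\<close>
      define p where "p = n + 2 * K"
      have "K * (p + p) = (2 * K) * p" by simp
      also have "\<dots> \<le> p * p" by (intro mult_right_mono) (simp_all add: p_def)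
      also have "\<dots> \<le> 2 ^ p * 2 ^ p" by (intro mult_mono) (auto intro: less_imp_le)
      finally have "K * (p + p) \<le> 2 ^ (p + p)" by (simp add: power_add)
      moreover have "n \<le> p + p" by (simp add: p_def)
      ultimately obtain m where "m \<ge> n" "K * m \<le> 2 ^ m" by blast
      then show ?thesis using L.le_trans[OF L.pow_le_pow[of x n m] small] x z pos by simp
    qed
    then have "le' x \<one>" using L.cic x z by blast
    have "le' (z [^] (2::nat)) (x \<otimes> z \<otimes> inv x)" using coarser le x z by simp
    also have "le' (x \<otimes> z \<otimes> inv x) (x \<otimes> z)" using L.mult_inv_pos_le(2) x z pos by simp
    also have "le' (x \<otimes> z) (\<one> \<otimes> z)" using L.le_mult_right[OF \<open>le' x \<one>\<close>] x z by simp
    finally have "le' (z \<otimes> z) (z \<otimes> \<one>)" using x z by (simp add: numeral_2_eq_2)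
    then have "le' z \<one>" using L.inv_mult_le_iff[of "z \<otimes> z" z \<one>] z by simp
    then have "le' (z [^] K) \<one>" using L.pow_mono[of z \<one> K] z by simp
    also have "le' \<one> (x [^] (2::nat))" using L.one_le_pow x pos by simp
    finally show False using le' x z by simp
  qed
  then show ?thesis using cic[of z "x [^] (2::nat)"] x z by simp
qed

text \<open>
If this failed, then after a local reversal \<open>z\<close> would be at most \<open>\<one>\<close>, and so would its conjugates.
The gain is that the bound does not depend on \<open>x\<close>, which below is a power of a fixed element.
\<close>

lemma conj_le_square:
  assumes x: "x \<in> carrier G" "\<one> \<preceq> x" and z: "z \<in> carrier G" "\<one> \<preceq> z"
  shows "x \<otimes> z \<otimes> inv x \<preceq> z [^] (2::nat)"
proof (rule ccontr)
  assume "\<not> ?thesis"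
  then obtain le' where "cic_preordered_group G le'"
    and coarser: "\<And>x y. \<lbrakk>x \<preceq> y; x \<in> carrier G; y \<in> carrier G\<rbrakk> \<Longrightarrow> le' x y"
    and le': "le' (z [^] (2::nat)) (x \<otimes> z \<otimes> inv x)" "\<not> le' (x \<otimes> z \<otimes> inv x) (z [^] (2::nat))"
    using reverse_locally[of "x \<otimes> z \<otimes> inv x" "z [^] (2::nat)"] x z by auto
  interpret L: cic_preordered_group G le' by fact
  have pos: "le' \<one> x" "le' \<one> z" using coarser x z by auto
  have "le' z \<one>" using L.square_le_conj le' x z pos by blast
  then have "le' (x \<otimes> z \<otimes> inv x) (x \<otimes> \<one> \<otimes> inv x)"
    using x z by (intro L.le_mult_left L.le_mult_right) auto
  also have "x \<otimes> \<one> \<otimes> inv x = \<one>" using x by simp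
  also have "le' \<one> (z [^] (2::nat))" using L.one_le_pow z pos by simp
  finally show False using le' x z by simp
qed

text \<open>
Here \<open>z\<close> is the commutator of \<open>x\<close> and \<open>y\<close>. Writing \<open>\<psi>\<close> for conjugation by \<open>x\<inverse>\<close>, the element \<open>y\<close> is
the product \<open>\<psi>(z) \<psi>\<^sup>2(z) \<dots> \<psi>\<^sup>n(z) \<psi>\<^sup>n(y)\<close>, in which each \<open>\<psi>\<^sup>i(z)\<close> is at least \<open>z\<close> and the last factor
is positive. So \<open>z\<^sup>n \<le> y\<close> for all \<open>n\<close>.
\<close>

lemma commutator_le_one_if_conj_le:
  assumes x: "x \<in> carrier G" and y: "y \<in> carrier G" "\<one> \<preceq> y"
    and z: "z \<in> carrier G" "x \<otimes> y \<otimes> inv x = z \<otimes> y"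
    and le: "x \<otimes> z \<otimes> inv x \<preceq> z"
  shows "z \<preceq> \<one>"
proof -
  let ?\<psi> = "\<lambda>v. inv x \<otimes> v \<otimes> x"
  have z_le: "z \<preceq> ?\<psi> z"
    using le x z mult_inv_le_iff[of "x \<otimes> z" z x] inv_mult_le_iff[of z "inv x" "z \<otimes> x"]
    by (simp add: m_assoc)
  have y_eq: "?\<psi> z \<otimes> ?\<psi> y = y"
  proof -
    have "?\<psi> z \<otimes> ?\<psi> y = inv x \<otimes> (z \<otimes> y) \<otimes> x" using x y z(1) by (simp add: m_assoc)
    also have "\<dots> = y" unfolding z(2)[symmetric] using x y by (simp add: m_assoc)
    finally show ?thesis .
  qed
  have "z [^] n \<otimes> (inv (x [^] n) \<otimes> y \<otimes> x [^] n) \<preceq> y" for n :: nat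
  proof (induction n)
    case (Suc n)
    define v where "v = inv (x [^] n) \<otimes> y \<otimes> x [^] n"
    have v: "v \<in> carrier G" using x y by (simp add: v_def)
    have "inv (x [^] Suc n) \<otimes> y \<otimes> x [^] Suc n = ?\<psi> v"
      using x y by (simp add: v_def m_assoc inv_mult_group)
    then have "z [^] Suc n \<otimes> (inv (x [^] Suc n) \<otimes> y \<otimes> x [^] Suc n) = z \<otimes> (z [^] n \<otimes> ?\<psi> v)"
      using nat_pow_Suc2[OF z(1)] x v z(1) by (simp add: m_assoc)
    moreover have "z \<otimes> (z [^] n \<otimes> ?\<psi> v) \<preceq> ?\<psi> z \<otimes> (?\<psi> z [^] n \<otimes> ?\<psi> v)"
      using x v z(1) pow_mono[OF z_le] z_le by (intro le_mult[of z] le_mult_right) auto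
    moreover have "?\<psi> z [^] n \<otimes> ?\<psi> v = ?\<psi> (z [^] n \<otimes> v)"
      using conj_pow[of "inv x" z n] x v z(1) by (simp add: m_assoc)
    moreover have "?\<psi> z \<otimes> ?\<psi> (z [^] n \<otimes> v) \<preceq> ?\<psi> z \<otimes> ?\<psi> y"
      using Suc x y v z(1) by (intro le_mult_left le_mult_right) (auto simp: v_def)
    ultimately show ?case
      using y_eq le_trans[of "z \<otimes> (z [^] n \<otimes> ?\<psi> v)" "?\<psi> z \<otimes> ?\<psi> (z [^] n \<otimes> v)" y] x y z(1) v
      by simp
  qed (use y in simp)
  moreover have "z [^] n \<preceq> z [^] n \<otimes> (inv (x [^] n) \<otimes> y \<otimes> x [^] n)" for n :: nat
    using le_mult_pos(2)[of "z [^] n" "inv (x [^] n) \<otimes> y \<otimes> x [^] n"] conj_pos[of y "inv (x [^] n)"] x y z(1)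
    by (simp add: pos_def)
  ultimately have "z [^] n \<preceq> y" for n :: nat
    using le_trans[of "z [^] n" "z [^] n \<otimes> (inv (x [^] n) \<otimes> y \<otimes> x [^] n)" y] x y z(1) by simp
  then show ?thesis using cic y z by blast
qed

text \<open>
The opposite case: conjugation by \<open>x\<^sup>n\<close> takes \<open>y\<close> to a product of \<open>n\<close> conjugates of \<open>z\<close>, all at
least \<open>z\<close>, with \<open>y\<close>. By \<open>conj_le_square\<close> it stays below \<open>y\<^sup>2\<close>, so again \<open>z\<^sup>n \<le> y\<close>.
\<close>

lemma commutator_le_one_if_le_conj:
  assumes x: "x \<in> carrier G" "\<one> \<preceq> x" and y: "y \<in> carrier G" "\<one> \<preceq> y"
    and z: "z \<in> carrier G" "x \<otimes> y \<otimes> inv x = z \<otimes> y"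
    and le: "z \<preceq> x \<otimes> z \<otimes> inv x"
  shows "z \<preceq> \<one>"
proof -
  let ?\<phi> = "\<lambda>v. x \<otimes> v \<otimes> inv x"
  have "z [^] n \<otimes> y \<preceq> x [^] n \<otimes> y \<otimes> inv (x [^] n)" for n :: nat
  proof (induction n)
    case (Suc n)
    have "z [^] Suc n \<otimes> y = z [^] n \<otimes> (z \<otimes> y)" using y z(1) by (simp add: m_assoc)
    also have "\<dots> \<preceq> ?\<phi> z [^] n \<otimes> (z \<otimes> y)"
      using x y z(1) pow_mono[OF le] by (intro le_mult_right) auto
    also have "\<dots> = ?\<phi> (z [^] n \<otimes> y)"
      unfolding z(2)[symmetric] using conj_pow[of x z n] x y z(1) by (simp add: m_assoc)
    also have "\<dots> \<preceq> ?\<phi> (x [^] n \<otimes> y \<otimes> inv (x [^] n))"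
      using Suc x y z(1) by (intro le_mult_left le_mult_right) auto
    also have "\<dots> = x [^] Suc n \<otimes> y \<otimes> inv (x [^] Suc n)"
      unfolding nat_pow_Suc2[OF x(1)] using x y by (simp add: m_assoc inv_mult_group)
    finally show ?case using x y z(1) by simp
  qed (use y in simp)
  also have "x [^] n \<otimes> y \<otimes> inv (x [^] n) \<preceq> y [^] (2::nat)" for n :: nat
    using conj_le_square one_le_pow x y by simp
  finally have "z [^] n \<otimes> y \<preceq> y \<otimes> y" for n :: nat
    using x y z(1) by (simp add: numeral_2_eq_2)
  then have "z [^] n \<preceq> y" for n :: nat
    using mult_inv_le_iff[of "z [^] n \<otimes> y" "y" y] y z(1) by (simp add: m_assoc)
  then show ?thesis using cic y z by blast
qed

text \<open>
Two local reversals reduce to the preceding cases. The first one makes the commutator \<open>z\<close> at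
least \<open>\<one>\<close>, the second one shows that \<open>z\<close> is then below its conjugate.
\<close>

lemma mult_le_mult_commute:
  assumes x: "x \<in> carrier G" "\<one> \<preceq> x" and y: "y \<in> carrier G" "\<one> \<preceq> y"
  shows "x \<otimes> y \<preceq> y \<otimes> x"
proof -
  define z where "z = x \<otimes> y \<otimes> inv x \<otimes> inv y"
  have z: "z \<in> carrier G" "x \<otimes> y \<otimes> inv x = z \<otimes> y"
    using x y by (simp_all add: z_def m_assoc)
  have "z \<preceq> \<one>"
  proof (rule ccontr)
    assume "\<not> z \<preceq> \<one>"
    then obtain le' where "cic_preordered_group G le'"
      and coarser: "\<And>x y. \<lbrakk>x \<preceq> y; x \<in> carrier G; y \<in> carrier G\<rbrakk> \<Longrightarrow> le' x y"
      and le': "le' \<one> z" "\<not> le' z \<one>"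
      using reverse_locally[of z \<one>] z by auto
    interpret L: cic_preordered_group G le' by fact
    have pos: "le' \<one> x" "le' \<one> y" using coarser x y by auto
    have "le' z (x \<otimes> z \<otimes> inv x)"
    proof (rule ccontr)
      assume "\<not> le' z (x \<otimes> z \<otimes> inv x)"
      then obtain le'' where "cic_preordered_group G le''"
        and coarser': "\<And>x y. \<lbrakk>le' x y; x \<in> carrier G; y \<in> carrier G\<rbrakk> \<Longrightarrow> le'' x y"
        and le'': "le'' (x \<otimes> z \<otimes> inv x) z" "\<not> le'' z (x \<otimes> z \<otimes> inv x)"
        using L.reverse_locally[of z "x \<otimes> z \<otimes> inv x"] x z by auto
      interpret LL: cic_preordered_group G le'' by fact
      have "le'' z \<one>"
        using LL.commutator_le_one_if_conj_le[OF x(1) y(1) _ z le''(1)] coarser' pos y by simp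
      moreover have "le'' \<one> (x \<otimes> z \<otimes> inv x)"
        using LL.conj_pos[of z x] coarser' le' x z by (simp add: LL.pos_def)
      ultimately show False using le'' LL.le_trans[of z \<one> "x \<otimes> z \<otimes> inv x"] x z by simp
    qed
    then have "le' z \<one>" using L.commutator_le_one_if_le_conj[OF x(1) _ y(1) _ z] pos by simp
    then show False using le' by simp
  qed
  then have "z \<otimes> (y \<otimes> x) \<preceq> \<one> \<otimes> (y \<otimes> x)" using x y z by (intro le_mult_right) auto
  then show ?thesis using x y by (simp add: z_def m_assoc)
qed

end

context preordered_group
begin

text \<open>
The largest directed convex subgroup: \<open>v\<close> belongs to it if \<open>u\<inverse> \<le> v \<le> u\<close> for some positive \<open>u\<close>.
\<close>

definition bounded_elements :: "'a set" where
  "bounded_elements = {v \<in> carrier G. \<exists>u\<in>pos. v \<preceq> u \<and> inv v \<preceq> u}"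

lemma subgroup_bounded_elements: "subgroup bounded_elements G"
proof (rule subgroupI)
  show "bounded_elements \<subseteq> carrier G" by (auto simp: bounded_elements_def)
  show "bounded_elements \<noteq> {}" using one_pos by (auto simp: bounded_elements_def intro!: exI[of _ \<one>] bexI[of _ \<one>])
  show "inv v \<in> bounded_elements" if "v \<in> bounded_elements" for v
    using that by (auto simp: bounded_elements_def)
  fix v v' assume "v \<in> bounded_elements" "v' \<in> bounded_elements"
  then obtain u u' where v: "v \<in> carrier G" "u \<in> pos" "v \<preceq> u" "inv v \<preceq> u"
    and v': "v' \<in> carrier G" "u' \<in> pos" "v' \<preceq> u'" "inv v' \<preceq> u'"
    by (auto simp: bounded_elements_def)
  have [simp]: "u \<in> carrier G" "u' \<in> carrier G" "\<one> \<preceq> u" using v v' by auto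
  have "v \<otimes> v' \<otimes> \<one> \<preceq> u \<otimes> u' \<otimes> u" using v v' by (intro le_mult) auto
  moreover have "\<one> \<otimes> (inv v' \<otimes> inv v) \<preceq> u \<otimes> (u' \<otimes> u)" using v v' by (intro le_mult) auto
  moreover have "u \<otimes> u' \<otimes> u \<in> pos" using v v' by (intro mult_pos)
  ultimately show "v \<otimes> v' \<in> bounded_elements"
    using v v' by (auto simp: bounded_elements_def inv_mult_group m_assoc intro!: bexI[of _ "u \<otimes> u' \<otimes> u"])
qed

text \<open>
Positive elements lie in the directed subgroup of bounded elements, to which
\<open>mult_le_mult_commute\<close> applies.
\<close>

lemma pos_mult_le_mult_commute:
  assumes cic: "\<And>c d. \<lbrakk>c \<in> carrier G; d \<in> carrier G; \<And>n::nat. c [^] n \<preceq> d\<rbrakk> \<Longrightarrow> c \<preceq> \<one>"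
    and x: "x \<in> pos" and y: "y \<in> pos"
  shows "x \<otimes> y \<preceq> y \<otimes> x"
proof -
  let ?H = "G\<lparr>carrier := bounded_elements\<rparr>"
  have sub: "v \<in> carrier G" if "v \<in> bounded_elements" for v
    using that by (simp add: bounded_elements_def)
  have pos_bounded: "u \<in> bounded_elements" if "u \<in> pos" for u
    using that mult_inv_pos_le(2)[of \<one> u] le_trans[of "inv u" \<one> u]
    by (auto simp: bounded_elements_def intro!: bexI[of _ u])
  interpret H: group ?H by (rule subgroup_imp_group[OF subgroup_bounded_elements])
  have "cic_preordered_group ?H (\<preceq>)"
  proof unfold_locales
    fix v assume "v \<in> carrier ?H"
    then obtain u where "u \<in> pos" "v \<preceq> u" by (auto simp: bounded_elements_def)
    then show "\<exists>u\<in>carrier ?H. \<one>\<^bsub>?H\<^esub> \<preceq> u \<and> v \<preceq> u"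
      using pos_bounded by (intro bexI[of _ u]) auto
  next
    fix c d assume "c \<in> carrier ?H" "d \<in> carrier ?H" "\<And>n::nat. c [^]\<^bsub>?H\<^esub> n \<preceq> d"
    then show "c \<preceq> \<one>\<^bsub>?H\<^esub>" using cic[of c d] sub by (simp flip: nat_pow_consistent)
  qed (auto dest: sub intro: le_trans le_mult_left le_mult_right)
  then show ?thesis
    using cic_preordered_group.mult_le_mult_commute[of ?H "(\<preceq>)" x y] x y pos_bounded by auto
qed

end

section \<open>Suprema and infima in subsets of an ordered type\<close>

text \<open>
Every statement on suprema below is also needed for infima. Both are covered by statements on a
pair of relations, on two possibly different types, that are both \<open>\<le>\<close> or both \<open>\<ge>\<close>.
\<close>

definition aligned :: "('a::order \<Rightarrow> 'a \<Rightarrow> bool) \<Rightarrow> ('b::order \<Rightarrow> 'b \<Rightarrow> bool) \<Rightarrow> bool" where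
  "aligned r s \<longleftrightarrow> r = (\<le>) \<and> s = (\<le>) \<or> r = (\<ge>) \<and> s = (\<ge>)"

lemma aligned_le [simp]: "aligned (\<le>) (\<le>)" and aligned_ge [simp]: "aligned (\<ge>) (\<ge>)"
  by (simp_all add: aligned_def)

lemma aligned_refl: "aligned r s \<Longrightarrow> r x x" "aligned r s \<Longrightarrow> s y y"
  by (auto simp: aligned_def)

lemma aligned_trans: "aligned r s \<Longrightarrow> r x y \<Longrightarrow> r y z \<Longrightarrow> r x z"
    "aligned r s \<Longrightarrow> s x' y' \<Longrightarrow> s y' z' \<Longrightarrow> s x' z'"
  by (auto simp: aligned_def)

lemma aligned_antisym: "aligned r s \<Longrightarrow> r x y \<Longrightarrow> r y x \<Longrightarrow> x = y"
    "aligned r s \<Longrightarrow> s x' y' \<Longrightarrow> s y' x' \<Longrightarrow> x' = y'"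
  by (auto simp: aligned_def)

lemma aligned_mono_on: "aligned r s \<Longrightarrow> mono_on X f \<longleftrightarrow> (\<forall>x\<in>X. \<forall>y\<in>X. r x y \<longrightarrow> s (f x) (f y))"
  by (auto simp: aligned_def monotone_on_def)

lemma aligned_fun_iff: "aligned r s \<Longrightarrow> r f g \<longleftrightarrow> (\<forall>x. s (f x) (g x))"
  by (auto simp: aligned_def le_fun_def)

lemma aligned_extensional_iff:
  "\<lbrakk>aligned r s; f \<in> extensional X; g \<in> extensional X\<rbrakk> \<Longrightarrow> r f g \<longleftrightarrow> (\<forall>x\<in>X. s (f x) (g x))"
  by (auto simp: aligned_def extensional_le_iff)

definition is_sup :: "('b \<Rightarrow> 'b \<Rightarrow> bool) \<Rightarrow> 'b set \<Rightarrow> 'b set \<Rightarrow> 'b \<Rightarrow> bool" where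
  "is_sup r Q S m \<longleftrightarrow> m \<in> Q \<and> (\<forall>x\<in>S. r x m) \<and> (\<forall>t\<in>Q. (\<forall>x\<in>S. r x t) \<longrightarrow> r m t)"

definition complete_on :: "('b \<Rightarrow> 'b \<Rightarrow> bool) \<Rightarrow> 'b set \<Rightarrow> bool" where
  "complete_on r Q \<longleftrightarrow> (\<forall>S\<subseteq>Q. \<exists>m. is_sup r Q S m)"

lemma is_sup_in: "is_sup r Q S m \<Longrightarrow> m \<in> Q"
  and is_sup_upper: "is_sup r Q S m \<Longrightarrow> x \<in> S \<Longrightarrow> r x m"
  and is_sup_least: "is_sup r Q S m \<Longrightarrow> t \<in> Q \<Longrightarrow> (\<And>x. x \<in> S \<Longrightarrow> r x t) \<Longrightarrow> r m t"
  by (auto simp: is_sup_def)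

lemma is_sup_unique: "\<lbrakk>aligned s r; is_sup r Q S m; is_sup r Q S m'\<rbrakk> \<Longrightarrow> m = m'"
  unfolding is_sup_def by (meson aligned_antisym(2))

lemma complete_on_dual:
  assumes "complete_on ((\<le>) :: 'b::order \<Rightarrow> _) Q"
  shows "complete_on (\<ge>) Q"
  unfolding complete_on_def
proof (intro allI impI)
  fix S assume "S \<subseteq> Q"
  obtain m where "is_sup (\<le>) Q {t \<in> Q. \<forall>x\<in>S. t \<le> x} m"
    using assms unfolding complete_on_def by (metis (no_types, lifting) mem_Collect_eq subsetI)
  then have "is_sup (\<ge>) Q S m" using \<open>S \<subseteq> Q\<close> by (auto simp: is_sup_def)
  then show "\<exists>m. is_sup (\<ge>) Q S m" ..
qed

section \<open>Darboux complete sets are complete lattices\<close>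

lemma dom_id_partial [simp]: "dom (id_partial A) = A"
  by (simp add: id_partial_def)

lemma id_partial_apply: "x \<in> A \<Longrightarrow> id_partial A x = Some x"
  by (simp add: id_partial_def)

lemma partial_function_on_id_partial: "A \<subseteq> Q \<Longrightarrow> partial_function_on Q Q (id_partial A)"
  by (auto simp: partial_function_on_def id_partial_def ran_def restrict_map_def monotone_on_def
      split: if_splits)

lemma Minf_in_hat [simp]: "Minf \<in> hat P" and Pinf_in_hat [simp]: "Pinf \<in> hat P"
  by (simp_all add: hat_def)

text \<open>
The identity on the down-closure \<open>D\<close> of \<open>S\<close> is a partial function. Sending all points outside
\<open>D\<close> to one upper bound \<open>t\<close> of \<open>S\<close> extends it, so its least extension maps \<open>+\<infinity>\<close> to the
least upper bound of \<open>S\<close>.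
\<close>

lemma Darboux_complete_imp_complete:
  fixes P :: "'a::order set"
  assumes "Darboux_complete P"
  shows "complete_on (\<le>) (hat P)"
  unfolding complete_on_def
proof (intro allI impI)
  fix S assume S: "S \<subseteq> hat P"
  define D where "D = {d \<in> hat P. \<exists>s\<in>S. d \<le> s}"
  have "D \<subseteq> hat P" by (auto simp: D_def)
  then obtain l where l: "l \<in> extensions (hat P) (hat P) (id_partial D)"
    and least: "\<And>f. f \<in> extensions (hat P) (hat P) (id_partial D) \<Longrightarrow> l \<le> f"
    using assms partial_function_on_id_partial unfolding Darboux_complete_def extremizable_def by metis
  have l_mono: "l x \<le> l y" if "x \<in> hat P" "y \<in> hat P" "x \<le> y" for x y
    using l that by (auto simp: extensions_def monotone_on_def)
  have "is_sup (\<le>) (hat P) S (l Pinf)"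
    unfolding is_sup_def
  proof (intro conjI ballI impI)
    show "l Pinf \<in> hat P" using l by (auto simp: extensions_def)
    fix s assume "s \<in> S"
    then have "s \<in> D" "s \<in> hat P" using S by (auto simp: D_def)
    then have "l s = s" using l by (auto simp: extensions_def id_partial_apply)
    then show "s \<le> l Pinf" using l_mono[of s Pinf] \<open>s \<in> hat P\<close> by simp
  next
    fix t assume t: "t \<in> hat P" "\<forall>s\<in>S. s \<le> t"
    define f where "f = (\<lambda>x\<in>hat P. if x \<in> D then x else t)"
    have "f \<in> extensions (hat P) (hat P) (id_partial D)"
      using t \<open>D \<subseteq> hat P\<close>
      by (auto simp: extensions_def f_def id_partial_apply monotone_on_def D_def intro: order_trans)
    then have "l Pinf \<le> f Pinf" using least by (simp add: le_fun_def)
    also have "f Pinf \<le> t" using t by (auto simp: f_def D_def)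
    finally show "l Pinf \<le> t" .
  qed
  then show "\<exists>m. is_sup (\<le>) (hat P) S m" ..
qed

section \<open>Suprema of order preserving functions\<close>

lemma OP_memI: "\<lbrakk>f \<in> Q \<rightarrow>\<^sub>E Q; mono_on Q f\<rbrakk> \<Longrightarrow> f \<in> OP Q"
  by (simp add: OP_def)

lemma OP_app: "\<lbrakk>f \<in> OP Q; x \<in> Q\<rbrakk> \<Longrightarrow> f x \<in> Q"
  by (auto simp: OP_def)

lemma OP_extensional: "f \<in> OP Q \<Longrightarrow> f \<in> extensional Q"
  by (simp add: OP_def PiE_iff)

lemma OP_mono: "\<lbrakk>aligned r' r; f \<in> OP Q; r x y; x \<in> Q; y \<in> Q\<rbrakk> \<Longrightarrow> r (f x) (f y)"
  by (auto simp: OP_def aligned_def monotone_on_def)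

lemma OP_pointwise_sup:
  fixes r' :: "('b::order \<Rightarrow> 'b) \<Rightarrow> ('b \<Rightarrow> 'b) \<Rightarrow> bool"
  assumes al: "aligned r' r" and compl: "complete_on r Q" and S: "S \<subseteq> OP Q"
  obtains f where "is_sup r' (OP Q) S f" "\<And>x. x \<in> Q \<Longrightarrow> is_sup r Q ((\<lambda>a. a x) ` S) (f x)"
proof
  define f where "f = (\<lambda>x\<in>Q. SOME m. is_sup r Q ((\<lambda>a. a x) ` S) m)"
  have f: "is_sup r Q ((\<lambda>a. a x) ` S) (f x)" if "x \<in> Q" for x
  proof -
    have "(\<lambda>a. a x) ` S \<subseteq> Q" using S that OP_app by auto
    then show ?thesis
      using compl that unfolding complete_on_def f_def by (simp add: someI_ex)
  qed
  then show "x \<in> Q \<Longrightarrow> is_sup r Q ((\<lambda>a. a x) ` S) (f x)" for x .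
  have "r (f x) (f y)" if xy: "x \<in> Q" "y \<in> Q" "r x y" for x y
  proof (rule is_sup_least[OF f[OF xy(1)]])
    show "f y \<in> Q" using is_sup_in f xy by metis
    fix v assume "v \<in> (\<lambda>a. a x) ` S"
    then obtain a where a: "a \<in> S" "v = a x" by blast
    then have "r v (a y)" using OP_mono[OF al] S xy by blast
    moreover have "r (a y) (f y)" using is_sup_upper[OF f[OF xy(2)]] a by blast
    ultimately show "r v (f y)" using aligned_trans(2)[OF al] by blast
  qed
  moreover have "aligned r r" using al by (auto simp: aligned_def)
  ultimately have f_OP: "f \<in> OP Q"
    using is_sup_in[OF f] by (intro OP_memI) (auto simp: aligned_mono_on f_def)
  show "is_sup r' (OP Q) S f"
    unfolding is_sup_def
  proof (intro conjI ballI impI)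
    fix a assume "a \<in> S"
    then show "r' a f"
      using aligned_extensional_iff[OF al, of a Q f] S f_OP OP_extensional is_sup_upper[OF f] by blast
  next
    fix g assume g: "g \<in> OP Q" "\<forall>a\<in>S. r' a g"
    then have "r (a x) (g x)" if "a \<in> S" for a x
      using that al aligned_fun_iff by blast
    then have "\<forall>x\<in>Q. r (f x) (g x)"
      using is_sup_least[OF f] g OP_app by blast
    then show "r' f g"
      using aligned_extensional_iff[OF al, of f Q g] g f_OP OP_extensional by blast
  qed (fact f_OP)
qed

lemma complete_on_OP:
  "\<lbrakk>aligned r' r; complete_on r Q\<rbrakk> \<Longrightarrow> complete_on r' (OP Q)"
  unfolding complete_on_def[of r'] using OP_pointwise_sup by metis

lemma is_sup_OP_pointwise:
  assumes "aligned r' r" "complete_on r Q" "S \<subseteq> OP Q" "is_sup r' (OP Q) S f" "x \<in> Q"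
  shows "is_sup r Q ((\<lambda>a. a x) ` S) (f x)"
proof -
  obtain g where g: "is_sup r' (OP Q) S g" "\<And>x. x \<in> Q \<Longrightarrow> is_sup r Q ((\<lambda>a. a x) ` S) (g x)"
    using OP_pointwise_sup[OF assms(1-3)] by blast
  moreover have "aligned r' r'" using assms(1) by (auto simp: aligned_def)
  ultimately have "f = g" using is_sup_unique assms(4) by metis
  then show ?thesis using g assms(5) by simp
qed

section \<open>Extremal extensions and the bounded Darboux set\<close>

lemma pointwise_sup_eq_iff:
  assumes "aligned r' r" "g \<in> extensional Q" "f \<in> extensional Q"
    and "\<And>x. x \<in> Q \<Longrightarrow> is_sup r Q (S x) (g x)"
  shows "g = f \<longleftrightarrow> (\<forall>x\<in>Q. is_sup r Q (S x) (f x))"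
proof
  assume "\<forall>x\<in>Q. is_sup r Q (S x) (f x)"
  then have "g x = f x" if "x \<in> Q" for x
    using is_sup_unique[OF assms(1)] assms(4) that by blast
  then show "g = f" using assms(2,3) by (intro extensionalityI[of g Q f])
qed (use assms(4) in blast)

text \<open>
The least extension sends \<open>x\<close> to the supremum of the values at points below \<open>x\<close>, and dually for
the greatest one.
\<close>

lemma extremal_extension:
  assumes al: "aligned r' r" and compl: "complete_on r R" and \<psi>: "partial_function_on X R \<psi>"
  obtains e where "e \<in> extensions X R \<psi>"
    "\<And>x. x \<in> X \<Longrightarrow> is_sup r R {the (\<psi> y) |y. y \<in> dom \<psi> \<and> r' y x} (e x)"
    "\<And>f x. \<lbrakk>f \<in> extensions X R \<psi>; x \<in> X\<rbrakk> \<Longrightarrow> r (e x) (f x)"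
proof
  let ?S = "\<lambda>x. {the (\<psi> y) |y. y \<in> dom \<psi> \<and> r' y x}"
  define e where "e = (\<lambda>x\<in>X. SOME m. is_sup r R (?S x) m)"
  have val: "the (\<psi> y) \<in> R" "y \<in> X" if "y \<in> dom \<psi>" for y
    using \<psi> that by (auto simp: partial_function_on_def ran_def)
  have mono: "r (the (\<psi> y)) (the (\<psi> z))" if "y \<in> dom \<psi>" "z \<in> dom \<psi>" "r' y z" for y z
    using \<psi> that aligned_mono_on[OF al, of "dom \<psi>" "the \<circ> \<psi>"] by (auto simp: partial_function_on_def)
  have e: "is_sup r R (?S x) (e x)" if "x \<in> X" for x
  proof -
    have "?S x \<subseteq> R" using val by auto
    then show ?thesis
      using compl that unfolding complete_on_def e_def by (simp add: someI_ex)
  qed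
  then show "x \<in> X \<Longrightarrow> is_sup r R (?S x) (e x)" for x .
  have "r (e x) (e y)" if "x \<in> X" "y \<in> X" "r' x y" for x y
  proof (rule is_sup_least[OF e[OF that(1)] is_sup_in[OF e[OF that(2)]]])
    fix v assume "v \<in> ?S x"
    then show "r v (e y)"
      using is_sup_upper[OF e[OF that(2)]] aligned_trans(1)[OF al _ that(3)] by blast
  qed
  then have "mono_on X e" by (simp add: aligned_mono_on[OF al])
  moreover have "the (\<psi> x) = e x" if "x \<in> dom \<psi>" for x
  proof (rule aligned_antisym(2)[OF al])
    show "r (the (\<psi> x)) (e x)"
      using is_sup_upper[OF e] val that aligned_refl(1)[OF al] by blast
    show "r (e x) (the (\<psi> x))"
      by (rule is_sup_least[OF e]) (use val mono[OF _ that] that in auto)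
  qed
  ultimately show "e \<in> extensions X R \<psi>"
    using is_sup_in[OF e] by (force simp: extensions_def e_def)
  show "r (e x) (f x)" if f: "f \<in> extensions X R \<psi>" and x: "x \<in> X" for f x
  proof (rule is_sup_least[OF e[OF x]])
    show "f x \<in> R" using f x by (auto simp: extensions_def)
    fix v assume "v \<in> ?S x"
    then obtain y where y: "y \<in> dom \<psi>" "r' y x" "v = the (\<psi> y)" by blast
    then have "v = f y" using f by (auto simp: extensions_def)
    then show "r v (f x)"
      using f x y val(2) by (auto simp: extensions_def aligned_mono_on[OF al])
  qed
qed

lemma complete_imp_extremizable:
  assumes "complete_on (\<le>) R" and "partial_function_on X R \<psi>"
  shows "extremizable X R \<psi>"
    and "x \<in> X \<Longrightarrow> is_sup (\<le>) R {the (\<psi> y) |y. y \<in> dom \<psi> \<and> y \<le> x} (lex_ext X R \<psi> x)"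
    and "x \<in> X \<Longrightarrow> is_sup (\<ge>) R {the (\<psi> y) |y. y \<in> dom \<psi> \<and> y \<ge> x} (uex_ext X R \<psi> x)"
proof -
  obtain l where l: "l \<in> extensions X R \<psi>"
    "\<And>x. x \<in> X \<Longrightarrow> is_sup (\<le>) R {the (\<psi> y) |y. y \<in> dom \<psi> \<and> y \<le> x} (l x)"
    "\<And>f x. \<lbrakk>f \<in> extensions X R \<psi>; x \<in> X\<rbrakk> \<Longrightarrow> l x \<le> f x"
    using extremal_extension[OF aligned_le assms] by blast
  obtain u where u: "u \<in> extensions X R \<psi>"
    "\<And>x. x \<in> X \<Longrightarrow> is_sup (\<ge>) R {the (\<psi> y) |y. y \<in> dom \<psi> \<and> y \<ge> x} (u x)"
    "\<And>f x. \<lbrakk>f \<in> extensions X R \<psi>; x \<in> X\<rbrakk> \<Longrightarrow> u x \<ge> f x"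
    using extremal_extension[OF aligned_ge complete_on_dual[OF assms(1)] assms(2)] by blast
  have ext: "f \<in> extensional X" if "f \<in> extensions X R \<psi>" for f
    using that by (simp add: extensions_def PiE_iff)
  have *: "l \<le> f \<and> f \<le> u" if "f \<in> extensions X R \<psi>" for f
    using l(3)[OF that] u(3)[OF that] extensional_le_iff[OF ext[OF l(1)] ext[OF that]]
      extensional_le_iff[OF ext[OF that] ext[OF u(1)]] by simp
  then show "extremizable X R \<psi>" unfolding extremizable_def using l(1) u(1) by blast
  then have "lex_ext X R \<psi> = l" "uex_ext X R \<psi> = u"
    using lex_uex_extremal[of X R \<psi>] * l(1) u(1) by (auto intro: order_antisym)
  with l u show "x \<in> X \<Longrightarrow> is_sup (\<le>) R {the (\<psi> y) |y. y \<in> dom \<psi> \<and> y \<le> x} (lex_ext X R \<psi> x)"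
    "x \<in> X \<Longrightarrow> is_sup (\<ge>) R {the (\<psi> y) |y. y \<in> dom \<psi> \<and> y \<ge> x} (uex_ext X R \<psi> x)" by simp_all
qed

text \<open>
\<open>f\<close> is pointwise the supremum of the nonempty set of the elements of \<open>A\<close> below it; for the
relations \<open>\<ge>\<close>, the infimum of those above it.
\<close>

definition approximable ::
    "(('b \<Rightarrow> 'b) \<Rightarrow> ('b \<Rightarrow> 'b) \<Rightarrow> bool) \<Rightarrow> ('b \<Rightarrow> 'b \<Rightarrow> bool) \<Rightarrow> 'b::order set \<Rightarrow> ('b \<Rightarrow> 'b) set \<Rightarrow>
      ('b \<Rightarrow> 'b) \<Rightarrow> bool" where
  "approximable r' r Q A f \<longleftrightarrow>
     f \<in> OP Q \<and> (\<exists>a\<in>A. r' a f) \<and> (\<forall>x\<in>Q. is_sup r Q ((\<lambda>a. a x) ` {a \<in> A. r' a f}) (f x))"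

lemma id_partial_values: "{the (id_partial A y) |y. y \<in> dom (id_partial A) \<and> r y x} = {a \<in> A. r a x}"
  by (force simp: id_partial_apply)

text \<open>
The identity of \<open>OP Q\<close> is itself an extension, so the two extreme extensions agree at \<open>f\<close> iff
both of them map \<open>f\<close> to \<open>f\<close>. Suprema in \<open>OP Q\<close> are computed pointwise, which turns the values of
these extensions at \<open>f\<close> into suprema and infima in \<open>Q\<close>.
\<close>

lemma BDar_id_partial_iff:
  fixes Q :: "'b::order set"
  assumes compl: "complete_on (\<le>) Q" and A: "A \<subseteq> OP Q"
  shows "f \<in> BDar (OP Q) (OP Q) (id_partial A) \<longleftrightarrow>
    approximable (\<le>) (\<le>) Q A f \<and> approximable (\<ge>) (\<ge>) Q A f" (is "?l \<longleftrightarrow> ?r")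
proof (cases "f \<in> OP Q")
  case f: True
  let ?lex = "lex_ext (OP Q) (OP Q) (id_partial A) f" and ?uex = "uex_ext (OP Q) (OP Q) (id_partial A) f"
  note compl' = complete_on_dual[OF compl]
  have complOP: "complete_on (\<le>) (OP Q)" by (rule complete_on_OP[OF aligned_le compl])
  have lex: "is_sup (\<le>) (OP Q) {a \<in> A. a \<le> f} ?lex"
    and uex: "is_sup (\<ge>) (OP Q) {a \<in> A. f \<le> a} ?uex"
    using complete_imp_extremizable(2,3)[OF complOP partial_function_on_id_partial[OF A] f]
    using id_partial_values[of A "(\<le>)" f] id_partial_values[of A "(\<ge>)" f] by simp_all
  have lex': "x \<in> Q \<Longrightarrow> is_sup (\<le>) Q ((\<lambda>a. a x) ` {a \<in> A. a \<le> f}) (?lex x)" for x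
    using is_sup_OP_pointwise[OF aligned_le compl _ lex] A by blast
  have uex': "x \<in> Q \<Longrightarrow> is_sup (\<ge>) Q ((\<lambda>a. a x) ` {a \<in> A. f \<le> a}) (?uex x)" for x
    using is_sup_OP_pointwise[OF aligned_ge compl' _ uex] A by blast
  have le: "?lex \<le> f" "f \<le> ?uex" using is_sup_least[OF lex f] is_sup_least[OF uex f] by auto
  have eq_iff: "?lex = ?uex \<longleftrightarrow> ?lex = f \<and> ?uex = f" using le by auto
  have "?lex = f \<longleftrightarrow> (\<forall>x\<in>Q. is_sup (\<le>) Q ((\<lambda>a. a x) ` {a \<in> A. a \<le> f}) (f x))"
    by (rule pointwise_sup_eq_iff[OF aligned_le OP_extensional[OF is_sup_in[OF lex]] OP_extensional[OF f] lex'])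
  moreover have "?uex = f \<longleftrightarrow> (\<forall>x\<in>Q. is_sup (\<ge>) Q ((\<lambda>a. a x) ` {a \<in> A. f \<le> a}) (f x))"
    by (rule pointwise_sup_eq_iff[OF aligned_ge OP_extensional[OF is_sup_in[OF uex]] OP_extensional[OF f] uex'])
  ultimately show ?thesis
    using f eq_iff by (auto simp: BDar_def Dar_def approximable_def)
qed (auto simp: BDar_def Dar_def approximable_def)


section \<open>The bounded Darboux set of a group of order preserving functions\<close>

locale cic_operator_group =
  fixes Q :: "'b::order set" and A :: "('b \<Rightarrow> 'b) set"
  assumes compl: "complete_on (\<le>) Q"
    and subgroup: "subgroup_of_monoid A (OP_monoid Q)"
    and cic: "completely_integrally_closed Q A"
begin

abbreviation G :: "('b \<Rightarrow> 'b) monoid" where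
  "G \<equiv> (OP_monoid Q)\<lparr>carrier := A\<rparr>"

abbreviation inv_op :: "('b \<Rightarrow> 'b) \<Rightarrow> 'b \<Rightarrow> 'b" where
  "inv_op \<equiv> m_inv G"

lemma A_subset: "A \<subseteq> OP Q"
  using subgroup submonoid.subset[of A "OP_monoid Q"] by (simp add: subgroup_of_monoid_def OP_monoid_def)

lemma OP_monoid_simps [simp]:
  "carrier (OP_monoid Q) = OP Q" "mult (OP_monoid Q) = compose Q" "\<one>\<^bsub>OP_monoid Q\<^esub> = (\<lambda>x\<in>Q. x)"
  by (simp_all add: OP_monoid_def)

sublocale group G
proof -
  interpret M: monoid "OP_monoid Q" by (rule monoid_OP_monoid)
  have sub: "submonoid A (OP_monoid Q)" using subgroup by (simp add: subgroup_of_monoid_def)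
  interpret G: monoid G by (rule submonoid.submonoid_is_monoid[OF sub monoid_OP_monoid])
  show "group G"
    by (rule G.group_l_invI) (use subgroup in \<open>auto simp: subgroup_of_monoid_def\<close>)
qed

sublocale preordered_group G "(\<le>)"
proof
  fix a b c :: "'b \<Rightarrow> 'b"
  assume "a \<le> b" "a \<in> carrier G" "b \<in> carrier G" "c \<in> carrier G"
  then have OP: "a \<in> OP Q" "b \<in> OP Q" "c \<in> OP Q" and le: "a x \<le> b x" for x
    using A_subset by (auto simp: le_fun_def)
  have "c (a x) \<le> c (b x)" if "x \<in> Q" for x
    using OP_mono[OF aligned_le OP(3) le] OP_app[OF OP(1) that] OP_app[OF OP(2) that] by blast
  then show "c \<otimes>\<^bsub>G\<^esub> a \<le> c \<otimes>\<^bsub>G\<^esub> b" "a \<otimes>\<^bsub>G\<^esub> c \<le> b \<otimes>\<^bsub>G\<^esub> c"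
    using le by (simp_all add: le_fun_def compose_def)
qed auto

lemma app_in: "\<lbrakk>a \<in> A; x \<in> Q\<rbrakk> \<Longrightarrow> a x \<in> Q"
  using A_subset OP_app by blast

lemma inv_in [simp]: "a \<in> A \<Longrightarrow> inv_op a \<in> A"
  using inv_closed by simp

lemma inv_app [simp]:
  assumes "a \<in> A" "x \<in> Q"
  shows "inv_op a (a x) = x" "a (inv_op a x) = x"
  using fun_cong[OF l_inv[of a], of x] fun_cong[OF r_inv[of a], of x] assms
  by (simp_all add: compose_def)

lemma compose_in: "\<lbrakk>a \<in> A; b \<in> A\<rbrakk> \<Longrightarrow> compose Q a b \<in> A"
  using m_closed[of a b] by simp

lemma app_rel_iff:
  assumes al: "aligned r' r" and "a \<in> A" "x \<in> Q" "y \<in> Q"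
  shows "r (a x) y \<longleftrightarrow> r x (inv_op a y)" "r y (a x) \<longleftrightarrow> r (inv_op a y) x"
proof -
  have A: "a \<in> OP Q" "inv_op a \<in> OP Q" using A_subset assms inv_in by auto
  note mono = OP_mono[OF al A(1)] OP_mono[OF al A(2)]
  note app = app_in[OF assms(2)] app_in[OF inv_in[OF assms(2)]]
  show "r (a x) y \<longleftrightarrow> r x (inv_op a y)"
    using mono(2)[of "a x" y] mono(1)[of x "inv_op a y"] assms app by auto
  show "r y (a x) \<longleftrightarrow> r (inv_op a y) x"
    using mono(2)[of y "a x"] mono(1)[of "inv_op a y" x] assms app by auto
qed

lemma compose_OP: "\<lbrakk>f \<in> OP Q; h \<in> OP Q\<rbrakk> \<Longrightarrow> compose Q f h \<in> OP Q"
  using monoid.m_closed[OF monoid_OP_monoid, of f Q h] by simp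

lemma rel_OP_iff:
  assumes "aligned r' r" "f \<in> OP Q" "g \<in> OP Q"
  shows "r' f g \<longleftrightarrow> (\<forall>x\<in>Q. r (f x) (g x))"
  using assms aligned_extensional_iff OP_extensional by blast

text \<open>
For \<open>a\<close> below \<open>f\<close> and \<open>b\<close> below \<open>h\<close> the product \<open>a b\<close> is below \<open>f h\<close>. If \<open>t\<close> bounds all \<open>a (b x)\<close>,
then \<open>a\<inverse> t\<close> bounds all \<open>b x\<close>, hence \<open>h x\<close>, and so \<open>t\<close> bounds all \<open>a (h x)\<close>, hence \<open>f (h x)\<close>. This
uses that the elements of \<open>A\<close>, being invertible, preserve suprema.
\<close>

lemma approximable_compose:
  assumes al: "aligned r' r" and f: "approximable r' r Q A f" and h: "approximable r' r Q A h"
  shows "approximable r' r Q A (compose Q f h)"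
proof -
  have OP: "f \<in> OP Q" "h \<in> OP Q" "compose Q f h \<in> OP Q"
    using f h compose_OP by (auto simp: approximable_def)
  have prod: "r' (compose Q a b) (compose Q f h)" if "a \<in> A" "r' a f" "b \<in> A" "r' b h" for a b
  proof -
    have ab: "a \<in> OP Q" "b \<in> OP Q" "compose Q a b \<in> OP Q" using that A_subset compose_OP by auto
    have "r (a (b x)) (f (h x))" if x: "x \<in> Q" for x
    proof (rule aligned_trans(2)[OF al])
      show "r (a (b x)) (f (b x))"
        using \<open>r' a f\<close> rel_OP_iff[OF al ab(1) OP(1)] OP_app[OF ab(2) x] by blast
      show "r (f (b x)) (f (h x))"
        using \<open>r' b h\<close> rel_OP_iff[OF al ab(2) OP(2)] x
        by (intro OP_mono[OF al OP(1)] OP_app[OF ab(2)] OP_app[OF OP(2)]) auto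
    qed
    then show ?thesis using rel_OP_iff[OF al ab(3) OP(3)] by (simp add: compose_def)
  qed
  have "is_sup r Q ((\<lambda>c. c x) ` {c \<in> A. r' c (compose Q f h)}) (compose Q f h x)" if x: "x \<in> Q" for x
    unfolding is_sup_def
  proof (intro conjI ballI impI)
    show "compose Q f h x \<in> Q" using OP_app OP x by blast
    fix v assume "v \<in> (\<lambda>c. c x) ` {c \<in> A. r' c (compose Q f h)}"
    then show "r v (compose Q f h x)" using rel_OP_iff[OF al _ OP(3)] A_subset x by blast
  next
    fix t assume t: "t \<in> Q" "\<forall>v\<in>(\<lambda>c. c x) ` {c \<in> A. r' c (compose Q f h)}. r v t"
    have hx: "h x \<in> Q" using OP x OP_app by blast
    have "r (f (h x)) t"
    proof (rule is_sup_least[where r = r and Q = Q])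
      show "is_sup r Q ((\<lambda>a. a (h x)) ` {a \<in> A. r' a f}) (f (h x))"
        using f hx by (simp add: approximable_def)
      fix v assume "v \<in> (\<lambda>a. a (h x)) ` {a \<in> A. r' a f}"
      then obtain a where a: "a \<in> A" "r' a f" "v = a (h x)" by blast
      have "r (h x) (inv_op a t)"
      proof (rule is_sup_least[where r = r and Q = Q])
        show "is_sup r Q ((\<lambda>b. b x) ` {b \<in> A. r' b h}) (h x)"
          using h x by (simp add: approximable_def)
        show "inv_op a t \<in> Q" using a t app_in by simp
        fix v assume "v \<in> (\<lambda>b. b x) ` {b \<in> A. r' b h}"
        then obtain b where b: "b \<in> A" "r' b h" "v = b x" by blast
        have "compose Q a b x \<in> (\<lambda>c. c x) ` {c \<in> A. r' c (compose Q f h)}"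
          using prod a b compose_in by blast
        then have "r (a (b x)) t" using t x by (auto simp: compose_def)
        then show "r v (inv_op a t)" using app_rel_iff(1)[OF al a(1)] b t x app_in by simp
      qed
      then show "r v t" using app_rel_iff(1)[OF al a(1) hx t(1)] a by simp
    qed (fact t)
    then show "r (compose Q f h x) t" using x by (simp add: compose_def)
  qed
  moreover obtain a b where "a \<in> A" "r' a f" "b \<in> A" "r' b h"
    using f h by (auto simp: approximable_def)
  then have "\<exists>c\<in>A. r' c (compose Q f h)" using prod compose_in by blast
  ultimately show ?thesis using OP by (simp add: approximable_def)
qed

lemma approximable_member:
  assumes al: "aligned r' r" and a: "a \<in> A"
  shows "approximable r' r Q A a"
proof -
  have "is_sup r Q ((\<lambda>c. c x) ` {c \<in> A. r' c a}) (a x)" if "x \<in> Q" for x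
    using that a app_in aligned_refl(1)[OF al] rel_OP_iff[OF al] A_subset
    unfolding is_sup_def by blast
  then show ?thesis
    using a A_subset aligned_refl(1)[OF al] by (auto simp: approximable_def)
qed

lemma pos_commute:
  assumes "x \<in> pos" "y \<in> pos"
  shows "compose Q x y = compose Q y x"
proof -
  have "submonoid A (OP_monoid Q)" using subgroup by (simp add: subgroup_of_monoid_def)
  then have pow: "c [^]\<^bsub>G\<^esub> n = c [^]\<^bsub>OP_monoid Q\<^esub> n" for c and n :: nat
    by (simp flip: monoid.nat_pow_consistent[OF monoid_OP_monoid])
  have "c \<le> \<one>\<^bsub>G\<^esub>" if "c \<in> A" "d \<in> A" "\<And>n::nat. c [^]\<^bsub>G\<^esub> n \<le> d" for c d
    using cic that by (auto simp: completely_integrally_closed_def pow)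
  then have "x \<otimes>\<^bsub>G\<^esub> y \<le> y \<otimes>\<^bsub>G\<^esub> x" "y \<otimes>\<^bsub>G\<^esub> x \<le> x \<otimes>\<^bsub>G\<^esub> y"
    using pos_mult_le_mult_commute assms by auto
  then show ?thesis by simp
qed

text \<open>
The only consequence of commutativity that is needed. The elements \<open>a0\<inverse> b\<close> and \<open>a\<inverse> b\<close> are positive
even though \<open>a\<close>, \<open>a0\<close> and \<open>b\<close> need not be; cancelling \<open>b\<close> from the equation that says that
they commute gives the claim.
\<close>

lemma inv_mult_conj:
  assumes A: "a \<in> A" "a0 \<in> A" "b \<in> A" and le: "a \<le> b" "a0 \<le> b" and y: "y \<in> Q"
  shows "inv_op a0 (b (inv_op a (a0 y))) = inv_op a (b y)"
proof -
  have pos: "compose Q (inv_op c) b \<in> pos" if "c \<in> A" "c \<le> b" for c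
    using le_mult_left[of c b "inv_op c"] l_inv[of c] that A compose_in by (simp add: pos_def)
  define x where "x = inv_op b (a0 y)"
  have x: "x \<in> Q" "b x = a0 y" using A y app_in by (simp_all add: x_def)
  have "compose Q (compose Q (inv_op a0) b) (compose Q (inv_op a) b) x
      = compose Q (compose Q (inv_op a) b) (compose Q (inv_op a0) b) x"
    using pos_commute[OF pos pos] A le by simp
  then show ?thesis using x A y app_in by (simp add: compose_def)
qed

abbreviation B :: "('b \<Rightarrow> 'b) set" where
  "B \<equiv> BDar (OP Q) (OP Q) (id_partial A)"

lemma B_iff: "f \<in> B \<longleftrightarrow> approximable (\<le>) (\<le>) Q A f \<and> approximable (\<ge>) (\<ge>) Q A f"
  by (rule BDar_id_partial_iff[OF compl A_subset])

text \<open>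
The inverse is the pointwise infimum \<open>g\<close> of the \<open>a\<inverse>\<close> with \<open>a \<le> f\<close>. It lies above all \<open>b\<inverse>\<close> with
\<open>b \<ge> f\<close>, and evaluating \<open>f (g x)\<close> both as a supremum of \<open>a (g x)\<close> and as an infimum of \<open>b (g x)\<close>
gives \<open>x\<close>. The other product is the infimum of the \<open>a\<inverse> b\<close>, whereas \<open>f g\<close> is that of the
\<open>b a\<inverse>\<close>; \<open>inv_mult_conj\<close> identifies the former, up to conjugation with a fixed \<open>a0 \<le> f\<close>, with the
latter. Finally \<open>g\<close> is also the supremum of the \<open>b\<inverse>\<close>, since a bound \<open>t\<close> of all \<open>b\<inverse> x\<close>
satisfies \<open>x \<le> b t\<close> for all \<open>b\<close>, hence \<open>x \<le> f t\<close> and \<open>g x \<le> g (f t) = t\<close>.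
\<close>

lemma B_inverse:
  assumes "f \<in> B"
  obtains g where "g \<in> B" "\<And>x. x \<in> Q \<Longrightarrow> f (g x) = x" "\<And>x. x \<in> Q \<Longrightarrow> g (f x) = x"
proof -
  define L where "L = {a \<in> A. a \<le> f}"
  define U where "U = {b \<in> A. f \<le> b}"
  have f: "f \<in> OP Q" and L_ne: "L \<noteq> {}" and U_ne: "U \<noteq> {}"
    and f_sup: "\<And>x. x \<in> Q \<Longrightarrow> is_sup (\<le>) Q ((\<lambda>a. a x) ` L) (f x)"
    and f_inf: "\<And>x. x \<in> Q \<Longrightarrow> is_sup (\<ge>) Q ((\<lambda>b. b x) ` U) (f x)"
    using assms by (auto simp: B_iff approximable_def L_def U_def)
  have LA: "a \<in> A" "a \<le> f" "a x \<le> f x" if "a \<in> L" for a x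
    using that by (auto simp: L_def le_fun_def)
  have UA: "b \<in> A" "f \<le> b" "f x \<le> b x" if "b \<in> U" for b x
    using that by (auto simp: U_def le_fun_def)
  have LU: "a \<le> b" if "a \<in> L" "b \<in> U" for a b
    using LA(2) UA(2) that order_trans by blast
  note le_iff = app_rel_iff[OF aligned_le]
  have inv_anti: "inv_op b \<le> inv_op a" if "a \<in> L" "b \<in> U" for a b
  proof -
    have AB: "a \<in> A" "b \<in> A" using LA UA that by auto
    have "inv_op b x \<le> inv_op a x" if x: "x \<in> Q" for x
    proof -
      have "a (inv_op b x) \<le> b (inv_op b x)" using LU[OF \<open>a \<in> L\<close> \<open>b \<in> U\<close>] by (simp add: le_fun_def)
      then show ?thesis using le_iff(1)[of a "inv_op b x" x] AB x app_in by simp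
    qed
    then show ?thesis using rel_OP_iff[OF aligned_le, of "inv_op b" "inv_op a"] A_subset AB inv_in by blast
  qed
  have "inv_op ` L \<subseteq> OP Q" using A_subset LA inv_in by blast
  then obtain g where g: "is_sup (\<ge>) (OP Q) (inv_op ` L) g"
    and "\<And>x. x \<in> Q \<Longrightarrow> is_sup (\<ge>) Q ((\<lambda>a. a x) ` inv_op ` L) (g x)"
    using OP_pointwise_sup[OF aligned_ge complete_on_dual[OF compl]] by metis
  then have g_inf: "is_sup (\<ge>) Q ((\<lambda>a. inv_op a x) ` L) (g x)" if "x \<in> Q" for x
    using that by (simp add: image_image)
  have gQ: "g x \<in> Q" if "x \<in> Q" for x using is_sup_in[OF g_inf[OF that]] .
  have fQ: "f x \<in> Q" if "x \<in> Q" for x using f that OP_app by blast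
  have g_OP: "g \<in> OP Q" using is_sup_in[OF g] .
  have g_le: "g x \<le> inv_op a x" if "a \<in> L" "x \<in> Q" for a x
    using is_sup_upper[OF g_inf[OF that(2)]] that(1) by blast
  have g_greatest: "t \<le> g x" if "x \<in> Q" "t \<in> Q" "\<And>a. a \<in> L \<Longrightarrow> t \<le> inv_op a x" for t x
    using is_sup_least[OF g_inf[OF that(1)] that(2)] that(3) by blast
  have inv_le_g: "inv_op b x \<le> g x" if "b \<in> U" "x \<in> Q" for b x
    using that inv_anti UA(1) app_in by (intro g_greatest) (auto simp: le_fun_def)
  have g_le_L: "g \<le> inv_op a" if "a \<in> L" for a
    using is_sup_upper[OF g] that by blast
  have U_le_g: "inv_op b \<le> g" if "b \<in> U" for b
    using inv_le_g[OF that] rel_OP_iff[OF aligned_le _ g_OP] UA(1)[OF that] A_subset inv_in by blast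
  have f_least: "f x \<le> t" if "x \<in> Q" "t \<in> Q" "\<And>a. a \<in> L \<Longrightarrow> a x \<le> t" for t x
    using is_sup_least[OF f_sup[OF that(1)] that(2)] that(3) by blast
  have f_greatest: "t \<le> f x" if "x \<in> Q" "t \<in> Q" "\<And>b. b \<in> U \<Longrightarrow> t \<le> b x" for t x
    using is_sup_least[OF f_inf[OF that(1)] that(2)] that(3) by blast
  have fg: "f (g x) = x" if x: "x \<in> Q" for x
  proof (rule order_antisym)
    show "f (g x) \<le> x"
      using x gQ g_le LA(1) le_iff(1) by (intro f_least) auto
    show "x \<le> f (g x)"
      using x gQ inv_le_g UA(1) le_iff(2) by (intro f_greatest) auto
  qed
  have gf: "g (f x) = x" if x: "x \<in> Q" for x
  proof (rule order_antisym)
    show "x \<le> g (f x)"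
    proof (rule g_greatest[OF fQ[OF x] x])
      fix a assume "a \<in> L"
      then show "x \<le> inv_op a (f x)" using LA le_iff(1)[of a x "f x"] x fQ by auto
    qed
    obtain a0 where a0: "a0 \<in> L" using L_ne by blast
    have y: "a0 x \<in> Q" using a0 LA(1) x app_in by blast
    have z: "g (f x) \<in> Q" "a0 (g (f x)) \<in> Q" using gQ fQ x a0 LA(1) app_in by auto
    \<comment> \<open>Conjugation with \<open>a0\<close> moves \<open>g f\<close> below \<open>f g\<close>, which is the identity.\<close>
    have "a0 (g (f x)) \<le> f (g (a0 x))"
    proof (rule f_greatest)
      fix b assume b: "b \<in> U"
      note bA = UA(1)[OF b]
      have "inv_op b (a0 (g (f x))) \<le> g (a0 x)"
      proof (rule g_greatest[OF y])
        show "inv_op b (a0 (g (f x))) \<in> Q" using app_in[OF inv_in[OF bA] z(2)] .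
        fix a assume a: "a \<in> L"
        note AB = LA(1)[OF a] LA(1)[OF a0] bA
        have v: "inv_op a (a0 x) \<in> Q" using app_in[OF inv_in[OF AB(1)] y] .
        have bx: "b x \<in> Q" using app_in[OF bA x] .
        have "g (f x) \<le> inv_op a (f x)" using g_le[OF a fQ[OF x]] .
        also have "\<dots> \<le> inv_op a (b x)"
          using OP_mono[OF aligned_le _ UA(3)[OF b] fQ[OF x] bx] inv_in[OF AB(1)] A_subset by blast
        also have "\<dots> = inv_op a0 (b (inv_op a (a0 x)))"
          using inv_mult_conj[OF AB LU[OF a b] LU[OF a0 b] x] by simp
        finally have "a0 (g (f x)) \<le> b (inv_op a (a0 x))"
          using le_iff(1)[OF AB(2) z(1) app_in[OF bA v]] by blast
        then show "inv_op b (a0 (g (f x))) \<le> inv_op a (a0 x)"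
          using le_iff(2)[OF bA v z(2)] by blast
      qed
      then show "a0 (g (f x)) \<le> b (g (a0 x))"
        using le_iff(2)[OF bA gQ[OF y] z(2)] by blast
    qed (fact gQ[OF y] z(2))+
    also have "\<dots> = a0 x" using fg y by simp
    finally show "g (f x) \<le> x"
      using le_iff(1)[of a0 "g (f x)" "a0 x"] a0 LA(1) x y gQ fQ by simp
  qed
  have "is_sup (\<ge>) Q ((\<lambda>c. c x) ` {c \<in> A. g \<le> c}) (g x)" if x: "x \<in> Q" for x
    unfolding is_sup_def
  proof (intro conjI ballI impI)
    fix t assume t: "t \<in> Q" "\<forall>v\<in>(\<lambda>c. c x) ` {c \<in> A. g \<le> c}. v \<ge> t"
    then show "g x \<ge> t" using x LA(1) g_le_L by (intro g_greatest) auto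
  qed (use gQ x in \<open>auto simp: le_fun_def\<close>)
  moreover have "is_sup (\<le>) Q ((\<lambda>c. c x) ` {c \<in> A. c \<le> g}) (g x)" if x: "x \<in> Q" for x
    unfolding is_sup_def
  proof (intro conjI ballI impI)
    fix t assume t: "t \<in> Q" "\<forall>v\<in>(\<lambda>c. c x) ` {c \<in> A. c \<le> g}. v \<le> t"
    then have "inv_op b x \<le> t" if "b \<in> U" for b using that UA(1) U_le_g by auto
    then have "x \<le> f t" using t x UA(1) le_iff(2) by (intro f_greatest) auto
    then have "g x \<le> g (f t)" using OP_mono[OF aligned_le g_OP] x t fQ by blast
    then show "g x \<le> t" using gf t by simp
  qed (use gQ x in \<open>auto simp: le_fun_def\<close>)
  moreover obtain a0 b0 where "a0 \<in> L" "b0 \<in> U" using L_ne U_ne by blast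
  then have "inv_op a0 \<in> A" "g \<le> inv_op a0" "inv_op b0 \<in> A" "inv_op b0 \<le> g"
    using LA(1) UA(1) g_le_L U_le_g by auto
  ultimately have "g \<in> B" using g_OP by (auto simp: B_iff approximable_def)
  then show thesis using that fg gf by blast
qed

theorem subgroup_BDar: "subgroup_of_monoid B (OP_monoid Q)"
  unfolding subgroup_of_monoid_def
proof (intro conjI ballI)
  have B_OP: "f \<in> OP Q" if "f \<in> B" for f using that by (simp add: B_iff approximable_def)
  show "submonoid B (OP_monoid Q)"
  proof
    show "B \<subseteq> carrier (OP_monoid Q)" using B_OP by auto
    show "\<one>\<^bsub>OP_monoid Q\<^esub> \<in> B"
      using approximable_member[OF aligned_le] approximable_member[OF aligned_ge] one_closed
      by (simp add: B_iff)
    show "f \<otimes>\<^bsub>OP_monoid Q\<^esub> h \<in> B" if "f \<in> B" "h \<in> B" for f h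
      using that approximable_compose[OF aligned_le] approximable_compose[OF aligned_ge]
      by (simp add: B_iff)
  qed
  fix f assume f: "f \<in> B"
  then obtain g where g: "g \<in> B" "\<And>x. x \<in> Q \<Longrightarrow> f (g x) = x" "\<And>x. x \<in> Q \<Longrightarrow> g (f x) = x"
    using B_inverse by metis
  then show "\<exists>g\<in>B. f \<otimes>\<^bsub>OP_monoid Q\<^esub> g = \<one>\<^bsub>OP_monoid Q\<^esub> \<and> g \<otimes>\<^bsub>OP_monoid Q\<^esub> f = \<one>\<^bsub>OP_monoid Q\<^esub>"
    by (intro bexI[of _ g]) (auto simp: compose_def fun_eq_iff)
qed

end

theorem proposition5p5:
  fixes P :: "'a::order set" and A :: "('a extended \<Rightarrow> 'a extended) set"
  assumes "Darboux_complete P"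
    and "subgroup_of_monoid A (OP_monoid (hat P))"
    and "completely_integrally_closed (hat P) A"
  shows "subgroup_of_monoid (BDar (OP (hat P)) (OP (hat P)) (id_partial A)) (OP_monoid (hat P))"
proof -
  interpret cic_operator_group "hat P" A
    using assms Darboux_complete_imp_complete by unfold_locales
  show ?thesis by (rule subgroup_BDar)
qed

end
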